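(* Let $n\ge 4$, let $M$ be a non-degenerate affine $2$-quasi-umbilical hypersurface in $\mathbb{A}^{n+1}$, and let $\mathrm{rank}(S-\rho\,h)=2$ be satisfied on some open non-empty subset $\mathcal{U}\subset\mathcal{U}_{\mathcal{S}}\subset M$, where $\rho$ is a function on $\mathcal{U}$. Put $A=S-\rho\,h$ and define on $\mathcal{U}$ the functions $$\alpha_2=\rho\,(\mathrm{tr}(A)+(n-1)\rho),\qquad \tau=\tfrac12\bigl((\mathrm{tr}(A))^{2}-\mathrm{tr}(A^{2})\bigr)+(n-2)\rho\,(\mathrm{tr}(A)+(n-2)\rho).$$ (i) If $\tau=0$ at a point $x\in\mathcal{U}$, then $\mathrm{rank}(\mathrm{Ric}(R^{\ast})-\alpha_2\,h)\le 1$ at this point. (ii) If $\tau\ne0$ at a point $x\in\mathcal{U}$, then at this point $\mathrm{rank}(\mathrm{Ric}(R^{\ast})-\alpha_2\,h)\ge2$ and $$(n-2)\tau\,R^{\ast}=\frac{n-2}{2}(\mathrm{Ric}(R^{\ast})-\alpha_2h)\wedge(\mathrm{Ric}(R^{\ast})-\alpha_2h)+\frac{(n-2)\tau\rho^{2}}{2}\,h\wedge h+(\tau-\kappa(R^{\ast})+n\alpha_2)\,h\wedge(\mathrm{Ric}(R^{\ast})-\alpha_2h)+h\wedge(\mathrm{Ric}(R^{\ast})-\alpha_2h)^{2};$$ moreover, the tensor $B=R^{\ast}-\frac{\alpha_2}{2(n-1)}\,h\wedge h$ satisfies at this point, with $\phi=\tau^{-1}$, $$B=\frac{\phi}{2}\mathrm{Ric}(B)\wedge\mathrm{Ric}(B)+\frac{\phi}{n-2}h\wedge(\mathrm{Ric}(B))^{2}+\frac{1-\kappa(B)\phi}{n-2}h\wedge\mathrm{Ric}(B)+\frac{\bigl((\kappa(B))^{2}-\mathrm{tr}((\mathrm{Ric}(B))^{2})\bigr)\phi-\kappa(B)}{2(n-2)(n-1)}\,h\wedge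 h$$ and $$\mathrm{Weyl}(B)=\phi\Bigl(\frac12\mathrm{Ric}(B)\wedge\mathrm{Ric}(B)+\frac{1}{n-2}h\wedge(\mathrm{Ric}(B))^{2}-\frac{\kappa(B)}{n-2}h\wedge\mathrm{Ric}(B)+\frac{(\kappa(B))^{2}-\mathrm{tr}((\mathrm{Ric}(B))^{2})}{2(n-2)(n-1)}\,h\wedge h\Bigr).$$ In particular, if $\tau\neq 0$ at every point of $\mathcal{U}$ and at every point of $\mathcal{U}$ one has $(\mathrm{Ric}(R^{\ast}))^{2}=\rho_1\,\mathrm{Ric}(R^{\ast})+\rho_2\,h$ for some $\rho_1,\rho_2\in\mathbb{R}$ (depending on the point), then on $\mathcal{U}$ $$\mathrm{Weyl}(R^{\ast})\cdot R^{\ast}-R^{\ast}\cdot\mathrm{Weyl}(R^{\ast})=Q(\mathrm{Ric}(R^{\ast}),\mathrm{Weyl}(R^{\ast}))-\frac{\kappa(R^{\ast})}{n-1}\,Q(h,\mathrm{Weyl}(R^{\ast})).$$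
   Context: $\mathbb{A}^{n+1}$ is $\mathbb{R}^{n+1}$ with its standard flat connection and the volume form given by the determinant. A hypersurface $M\subset\mathbb{A}^{n+1}$ (connected, smooth) is non-degenerate if its affine fundamental form is non-degenerate; it then carries its affine normal $\xi$, the Blaschke-Berwald metric $h$ (a semi-Riemannian metric), the induced connection $\nabla$ and the affine shape operator $\mathcal{S}$ (Gauss and Weingarten formulas $\widetilde\nabla_XY=\nabla_XY+h(X,Y)\xi$, $\widetilde\nabla_X\xi=-\mathcal{S}X$); the operator $\mathcal{S}$ is $h$-self-adjoint. $\mathcal{U}_{\mathcal{S}}$ is the set of points $x\in M$ at which $\mathcal{S}_x$ is not a multiple of the identity. Set $S(X,Y)=h(X,\mathcal{S}Y)$. $M$ is affine $2$-quasi-umbilical at $x\in\mathcal{U}_{\mathcal{S}}$ if $\mathrm{rank}(S-\rho h)=2$ at $x$ for some $\rho\in\mathbb{R}$. For a symmetric $(0,2)$-tensor $A$ with associated endomorphism $\mathcal{A}$, $h(\mathcal{A}X,Y)=A(X,Y)$, put $A^{2}(X,Y)=A(\mathcal{A}X,Y)$ and $\mathrm{tr}(A)=\mathrm{tr}(\mathcal{A})$ (trace with respect to $h$). For symmetric $(0,2)$-tensors $E,F$ the Kulkarni-Nomizu product is $(E\wedge F)(X_1,X_2,X_3,X_4)=E(X_1,X_4)F(X_2,X_3)+E(X_2,X_3)F(X_1,X_4)-E(X_1,X_3)F(X_2,X_4)-E(X_2,X_4)F(X_1,X_3)$. The Opozda-Verstraelen affine curvature tensor is $R^{\ast}=\frac12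 S\wedge S$. For a $(0,4)$-tensor $B$ with the algebraic symmetries of a curvature tensor, and $(e_j)$ an $h$-orthonormal basis with $h(e_j,e_j)=\varepsilon_j=\pm1$: $\mathrm{Ric}(B)(X,Y)=\sum_j\varepsilon_jB(e_j,X,Y,e_j)$, $\kappa(B)=\sum_j\varepsilon_j\mathrm{Ric}(B)(e_j,e_j)$, $\mathrm{Weyl}(B)=B-\frac{1}{n-2}h\wedge\mathrm{Ric}(B)+\frac{\kappa(B)}{2(n-2)(n-1)}h\wedge h$. For such $B$ let $\mathcal{B}(X,Y)$ be the endomorphism with $h(\mathcal{B}(X_1,X_2)X_3,X_4)=B(X_1,X_2,X_3,X_4)$. For a $(0,k)$-tensor $T$, $(B\cdot T)(X_1,\dots,X_k,X,Y)=-\sum_{i=1}^{k}T(X_1,\dots,\mathcal{B}(X,Y)X_i,\dots,X_k)$. For a symmetric $(0,2)$-tensor $A$, let $(X\wedge_AY)Z=A(Y,Z)X-A(X,Z)Y$ and $Q(A,T)(X_1,\dots,X_k,X,Y)=-\sum_{i=1}^{k}T(X_1,\dots,(X\wedge_AY)X_i,\dots,X_k)$. *)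

theory Defs
  imports "HOL-Analysis.Analysis"
begin

section \<open>Immersed hypersurfaces of affine space\<close>

text \<open>
  The affine space of dimension \<open>n + 1\<close>, where \<open>n = CARD('n)\<close>, is modelled by the vectors
  indexed by \<open>'n option\<close>.  The flat connection is the ordinary derivative and the volume form
  is \<open>det\<close>.
\<close>

type_synonym 'n affine_space = "(real, 'n option) vec"

primrec Ck_on :: "nat \<Rightarrow> 'a::real_normed_vector set \<Rightarrow> ('a \<Rightarrow> 'b::real_normed_vector) \<Rightarrow> bool" where
  "Ck_on 0 U f \<longleftrightarrow> continuous_on U f"
| "Ck_on (Suc k) U f \<longleftrightarrow>
     (\<forall>u\<in>U. f differentiable (at u)) \<and> (\<forall>v. Ck_on k U (\<lambda>u. frechet_derivative f (at u) v))"

definition smooth_on :: "'a::real_normed_vector set \<Rightarrow> ('a \<Rightarrow> 'b::real_normed_vector) \<Rightarrow> bool" where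
  "smooth_on U f \<longleftrightarrow> (\<forall>k. Ck_on k U f)"

text \<open>
  A hypersurface is a topological space \<open>M\<close> with a map \<open>F\<close> into affine space that is locally
  parametrized by smooth immersions.  The smooth structure of \<open>M\<close> is the one making \<open>F\<close> an
  immersion; its charts are the inverses of the local parametrizations below.  An embedded
  hypersurface is the case where \<open>M\<close> is a subspace of affine space and \<open>F\<close> is the identity.
\<close>

definition local_param ::
  "'p topology \<Rightarrow> ('p \<Rightarrow> 'n affine_space) \<Rightarrow> (real^'n) set \<Rightarrow> (real^'n \<Rightarrow> 'p) \<Rightarrow> bool" where
  "local_param M F U \<phi> \<longleftrightarrow>
     open U \<and> openin M (\<phi> ` U) \<and>
     homeomorphic_map (top_of_set U) (subtopology M (\<phi> ` U)) \<phi> \<and>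
     smooth_on U (F \<circ> \<phi>) \<and>
     (\<forall>u\<in>U. inj (frechet_derivative (F \<circ> \<phi>) (at u)))"

definition hypersurface :: "'p topology \<Rightarrow> ('p \<Rightarrow> 'n::finite affine_space) \<Rightarrow> bool" where
  "hypersurface M F \<longleftrightarrow>
     Hausdorff_space M \<and> second_countable M \<and> connected_space M \<and>
     (\<forall>p\<in>topspace M. \<exists>U \<phi>. local_param M F U \<phi> \<and> p \<in> \<phi> ` U)"

definition tangent_space ::
  "'p topology \<Rightarrow> ('p \<Rightarrow> 'n::finite affine_space) \<Rightarrow> 'p \<Rightarrow> 'n affine_space set" where
  "tangent_space M F p =
     {G' a | U \<phi> u G' a. local_param M F U \<phi> \<and> u \<in> U \<and> \<phi> u = p \<and>
        ((F \<circ> \<phi>) has_derivative G') (at u)}"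

definition smooth_near ::
  "'p topology \<Rightarrow> ('p \<Rightarrow> 'n::finite affine_space) \<Rightarrow> 'p \<Rightarrow> ('p \<Rightarrow> 'n affine_space) \<Rightarrow> bool" where
  "smooth_near M F p Z \<longleftrightarrow>
     (\<exists>U \<phi>. local_param M F U \<phi> \<and> p \<in> \<phi> ` U \<and> smooth_on U (Z \<circ> \<phi>))"

definition tangent_field_near ::
  "'p topology \<Rightarrow> ('p \<Rightarrow> 'n::finite affine_space) \<Rightarrow> 'p \<Rightarrow> ('p \<Rightarrow> 'n affine_space) \<Rightarrow> bool" where
  "tangent_field_near M F p Z \<longleftrightarrow>
     (\<exists>U \<phi>. local_param M F U \<phi> \<and> p \<in> \<phi> ` U \<and> smooth_on U (Z \<circ> \<phi>) \<and>
        (\<forall>q\<in>\<phi> ` U. Z q \<in> tangent_space M F q))"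

text \<open>The flat derivative at \<open>p\<close>, in the tangent direction \<open>X\<close>, of a vector field \<open>Z\<close> along \<open>F\<close>.\<close>

definition flat_deriv ::
  "'p topology \<Rightarrow> ('p \<Rightarrow> 'n::finite affine_space) \<Rightarrow> 'p \<Rightarrow> 'n affine_space \<Rightarrow>
     ('p \<Rightarrow> 'n affine_space) \<Rightarrow> 'n affine_space" where
  "flat_deriv M F p X Z =
     (THE w. \<exists>U \<phi> u G' Z' a. local_param M F U \<phi> \<and> u \<in> U \<and> \<phi> u = p \<and>
        ((F \<circ> \<phi>) has_derivative G') (at u) \<and> ((Z \<circ> \<phi>) has_derivative Z') (at u) \<and>
        G' a = X \<and> w = Z' a)"

text \<open>
  Gauss formula: if \<open>Z\<close> is a tangent field near \<open>p\<close> with \<open>Z p = Y\<close>, then the derivative of \<open>Z\<close> in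
  direction \<open>X\<close> is a tangent vector plus \<open>h(X,Y) N\<close>.  The form depends on the transversal field
  only through its value \<open>N\<close> at \<open>p\<close>.
\<close>

definition affine_fundamental_form ::
  "'p topology \<Rightarrow> ('p \<Rightarrow> 'n::finite affine_space) \<Rightarrow> 'p \<Rightarrow> 'n affine_space \<Rightarrow>
     'n affine_space \<Rightarrow> 'n affine_space \<Rightarrow> real" where
  "affine_fundamental_form M F p N X Y =
     (THE c. \<forall>Z. tangent_field_near M F p Z \<and> Z p = Y \<longrightarrow>
        flat_deriv M F p X Z - c *\<^sub>R N \<in> tangent_space M F p)"

definition nondegenerate_hypersurface :: "'p topology \<Rightarrow> ('p \<Rightarrow> 'n::finite affine_space) \<Rightarrow> bool" where
  "nondegenerate_hypersurface M F \<longleftrightarrow>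
     hypersurface M F \<and>
     (\<forall>p\<in>topspace M. \<forall>N. N \<notin> tangent_space M F p \<longrightarrow>
        (\<forall>X\<in>tangent_space M F p.
           (\<forall>Y\<in>tangent_space M F p. affine_fundamental_form M F p N X Y = 0) \<longrightarrow> X = 0))"

text \<open>
  The affine normal is determined, up to sign, as the smooth transversal field that is
  equiaffine (its derivatives are tangent) and whose induced volume form
  \<open>\<theta>(X\<^sub>1,\<dots>,X\<^sub>n) = det(X\<^sub>1,\<dots>,X\<^sub>n,\<xi>)\<close> is, up to sign, the volume form of \<open>h\<close>.
\<close>

definition affine_normal ::
  "'p topology \<Rightarrow> ('p \<Rightarrow> 'n::finite affine_space) \<Rightarrow> ('p \<Rightarrow> 'n affine_space) \<Rightarrow> bool" where
  "affine_normal M F \<xi> \<longleftrightarrow>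
     (\<forall>p\<in>topspace M.
        smooth_near M F p \<xi> \<and>
        \<xi> p \<notin> tangent_space M F p \<and>
        (\<forall>X\<in>tangent_space M F p. flat_deriv M F p X \<xi> \<in> tangent_space M F p) \<and>
        (\<forall>X :: 'n \<Rightarrow> 'n affine_space. (\<forall>i. X i \<in> tangent_space M F p) \<longrightarrow>
           \<bar>det (\<chi> i j. affine_fundamental_form M F p (\<xi> p) (X i) (X j))\<bar> =
             (det (\<chi> i. case i of None \<Rightarrow> \<xi> p | Some k \<Rightarrow> X k))\<^sup>2))"

definition blaschke_metric ::
  "'p topology \<Rightarrow> ('p \<Rightarrow> 'n::finite affine_space) \<Rightarrow> ('p \<Rightarrow> 'n affine_space) \<Rightarrow> 'p \<Rightarrow>
     'n affine_space \<Rightarrow> 'n affine_space \<Rightarrow> real" where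
  "blaschke_metric M F \<xi> p = affine_fundamental_form M F p (\<xi> p)"

definition shape_operator ::
  "'p topology \<Rightarrow> ('p \<Rightarrow> 'n::finite affine_space) \<Rightarrow> ('p \<Rightarrow> 'n affine_space) \<Rightarrow> 'p \<Rightarrow>
     'n affine_space \<Rightarrow> 'n affine_space" where
  "shape_operator M F \<xi> p X = - flat_deriv M F p X \<xi>"

definition shape_form ::
  "'p topology \<Rightarrow> ('p \<Rightarrow> 'n::finite affine_space) \<Rightarrow> ('p \<Rightarrow> 'n affine_space) \<Rightarrow> 'p \<Rightarrow>
     'n affine_space \<Rightarrow> 'n affine_space \<Rightarrow> real" where
  "shape_form M F \<xi> p X Y = blaschke_metric M F \<xi> p X (shape_operator M F \<xi> p Y)"

definition nonumbilic_set ::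
  "'p topology \<Rightarrow> ('p \<Rightarrow> 'n::finite affine_space) \<Rightarrow> ('p \<Rightarrow> 'n affine_space) \<Rightarrow> 'p set" where
  "nonumbilic_set M F \<xi> =
     {p \<in> topspace M.
        \<not> (\<exists>c. \<forall>X\<in>tangent_space M F p. shape_operator M F \<xi> p X = c *\<^sub>R X)}"

section \<open>Tensors on a tangent space\<close>

text \<open>
  In this section \<open>V\<close> is an \<open>n\<close>-dimensional subspace of affine space (a tangent space) and \<open>h\<close> a
  scalar product on it.  Tensors on \<open>V\<close> are functions of ambient vectors of which only the values
  at arguments in \<open>V\<close> matter.
\<close>

type_synonym 'v tensor2 = "'v \<Rightarrow> 'v \<Rightarrow> real"
type_synonym 'v tensor4 = "'v \<Rightarrow> 'v \<Rightarrow> 'v \<Rightarrow> 'v \<Rightarrow> real"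
type_synonym 'v tensor6 = "'v \<Rightarrow> 'v \<Rightarrow> 'v \<Rightarrow> 'v \<Rightarrow> 'v \<Rightarrow> 'v \<Rightarrow> real"

definition basis_of :: "'n::finite affine_space set \<Rightarrow> ('n \<Rightarrow> 'n affine_space) \<Rightarrow> bool" where
  "basis_of V b \<longleftrightarrow> inj b \<and> independent (range b) \<and> span (range b) = V"

definition orthonormal_basis ::
  "'n::finite affine_space set \<Rightarrow> 'n affine_space tensor2 \<Rightarrow> ('n \<Rightarrow> 'n affine_space) \<Rightarrow> bool" where
  "orthonormal_basis V h e \<longleftrightarrow>
     basis_of V e \<and> (\<forall>i j. i \<noteq> j \<longrightarrow> h (e i) (e j) = 0) \<and>
     (\<forall>j. h (e j) (e j) = 1 \<or> h (e j) (e j) = -1)"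

definition some_basis :: "'n::finite affine_space set \<Rightarrow> 'n \<Rightarrow> 'n affine_space" where
  "some_basis V = (SOME b. basis_of V b)"

definition some_onb ::
  "'n::finite affine_space set \<Rightarrow> 'n affine_space tensor2 \<Rightarrow> 'n \<Rightarrow> 'n affine_space" where
  "some_onb V h = (SOME e. orthonormal_basis V h e)"

text \<open>Rank of a \<open>(0,2)\<close>-tensor: the rank of its Gram matrix in a basis of \<open>V\<close>.\<close>

definition form_rank :: "'n::finite affine_space set \<Rightarrow> 'n affine_space tensor2 \<Rightarrow> nat" where
  "form_rank V A = rank (\<chi> i j. A (some_basis V i) (some_basis V j))"

text \<open>Trace of an endomorphism: the trace of its matrix in a basis of \<open>V\<close>.\<close>

definition endo_trace ::
  "'n::finite affine_space set \<Rightarrow> ('n affine_space \<Rightarrow> 'n affine_space) \<Rightarrow> real" where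
  "endo_trace V L =
     trace (\<chi> i j. representation (range (some_basis V)) (L (some_basis V j)) (some_basis V i))"

definition endo_of ::
  "'n::finite affine_space set \<Rightarrow> 'n affine_space tensor2 \<Rightarrow> 'n affine_space tensor2 \<Rightarrow>
     'n affine_space \<Rightarrow> 'n affine_space" where
  "endo_of V h A X = (THE W. W \<in> V \<and> (\<forall>Y\<in>V. h W Y = A X Y))"

definition sq2 ::
  "'n::finite affine_space set \<Rightarrow> 'n affine_space tensor2 \<Rightarrow> 'n affine_space tensor2 \<Rightarrow>
     'n affine_space tensor2" where
  "sq2 V h A X Y = A (endo_of V h A X) Y"

definition tr2 ::
  "'n::finite affine_space set \<Rightarrow> 'n affine_space tensor2 \<Rightarrow> 'n affine_space tensor2 \<Rightarrow> real" where
  "tr2 V h A = endo_trace V (endo_of V h A)"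

definition KN :: "'v tensor2 \<Rightarrow> 'v tensor2 \<Rightarrow> 'v tensor4" where
  "KN E F X1 X2 X3 X4 =
     E X1 X4 * F X2 X3 + E X2 X3 * F X1 X4 - E X1 X3 * F X2 X4 - E X2 X4 * F X1 X3"

definition Ric ::
  "'n::finite affine_space set \<Rightarrow> 'n affine_space tensor2 \<Rightarrow> 'n affine_space tensor4 \<Rightarrow>
     'n affine_space tensor2" where
  "Ric V h B X Y = (\<Sum>j\<in>UNIV. let e = some_onb V h j in h e e * B e X Y e)"

definition scal ::
  "'n::finite affine_space set \<Rightarrow> 'n affine_space tensor2 \<Rightarrow> 'n affine_space tensor4 \<Rightarrow> real" where
  "scal V h B = (\<Sum>j\<in>UNIV. let e = some_onb V h j in h e e * Ric V h B e e)"

definition Weyl ::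
  "'n::finite affine_space set \<Rightarrow> 'n affine_space tensor2 \<Rightarrow> 'n affine_space tensor4 \<Rightarrow>
     'n affine_space tensor4" where
  "Weyl V h B X1 X2 X3 X4 =
     (let n = real CARD('n) in
        B X1 X2 X3 X4 - 1 / (n - 2) * KN h (Ric V h B) X1 X2 X3 X4
        + scal V h B / (2 * (n - 2) * (n - 1)) * KN h h X1 X2 X3 X4)"

definition curv_op ::
  "'n::finite affine_space set \<Rightarrow> 'n affine_space tensor2 \<Rightarrow> 'n affine_space tensor4 \<Rightarrow>
     'n affine_space \<Rightarrow> 'n affine_space \<Rightarrow> 'n affine_space \<Rightarrow> 'n affine_space" where
  "curv_op V h B X1 X2 X3 = (THE W. W \<in> V \<and> (\<forall>X4\<in>V. h W X4 = B X1 X2 X3 X4))"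

text \<open>The derivation action of an endomorphism field on \<open>(0,4)\<close>-tensors, with its sign.\<close>

definition endo_act ::
  "('v \<Rightarrow> 'v \<Rightarrow> 'v \<Rightarrow> 'v) \<Rightarrow> 'v tensor4 \<Rightarrow> 'v tensor6" where
  "endo_act L T X1 X2 X3 X4 X Y =
     - (T (L X Y X1) X2 X3 X4 + T X1 (L X Y X2) X3 X4
        + T X1 X2 (L X Y X3) X4 + T X1 X2 X3 (L X Y X4))"

definition curv_dot ::
  "'n::finite affine_space set \<Rightarrow> 'n affine_space tensor2 \<Rightarrow> 'n affine_space tensor4 \<Rightarrow>
     'n affine_space tensor4 \<Rightarrow> 'n affine_space tensor6" where
  "curv_dot V h B T = endo_act (curv_op V h B) T"

definition wedge_op :: "'v::real_vector tensor2 \<Rightarrow> 'v \<Rightarrow> 'v \<Rightarrow> 'v \<Rightarrow> 'v" where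
  "wedge_op A X Y Z = A Y Z *\<^sub>R X - A X Z *\<^sub>R Y"

definition Tachibana :: "'v::real_vector tensor2 \<Rightarrow> 'v tensor4 \<Rightarrow> 'v tensor6" where
  "Tachibana A T = endo_act (wedge_op A) T"

definition sub_smult :: "'v tensor2 \<Rightarrow> real \<Rightarrow> 'v tensor2 \<Rightarrow> 'v tensor2" where
  "sub_smult A c E X Y = A X Y - c * E X Y"

section \<open>Curvature of affine hypersurfaces\<close>

definition opozda_verstraelen ::
  "'p topology \<Rightarrow> ('p \<Rightarrow> 'n::finite affine_space) \<Rightarrow> ('p \<Rightarrow> 'n affine_space) \<Rightarrow> 'p \<Rightarrow>
     'n affine_space tensor4" where
  "opozda_verstraelen M F \<xi> p X1 X2 X3 X4 =
     1 / 2 * KN (shape_form M F \<xi> p) (shape_form M F \<xi> p) X1 X2 X3 X4"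

definition quasi_umbilical_at ::
  "nat \<Rightarrow> 'p topology \<Rightarrow> ('p \<Rightarrow> 'n::finite affine_space) \<Rightarrow> ('p \<Rightarrow> 'n affine_space) \<Rightarrow> 'p \<Rightarrow> bool" where
  "quasi_umbilical_at k M F \<xi> p \<longleftrightarrow>
     p \<in> nonumbilic_set M F \<xi> \<and>
     (\<exists>\<rho>. form_rank (tangent_space M F p)
             (sub_smult (shape_form M F \<xi> p) \<rho> (blaschke_metric M F \<xi> p)) = k)"

definition quasi_umbilical_hypersurface ::
  "nat \<Rightarrow> 'p topology \<Rightarrow> ('p \<Rightarrow> 'n::finite affine_space) \<Rightarrow> ('p \<Rightarrow> 'n affine_space) \<Rightarrow> bool" where
  "quasi_umbilical_hypersurface k M F \<xi> \<longleftrightarrow>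
     (\<forall>p\<in>nonumbilic_set M F \<xi>. quasi_umbilical_at k M F \<xi> p)"

end

theory Submission
  imports Defs
begin

text \<open>
  Everything except the symmetry of \<open>h\<close> and \<open>S\<close> is pointwise linear algebra.  Write \<open>A\<close> for \<open>S - \<rho> h\<close>,
  \<open>t = tr A\<close>, \<open>2 s = t\<^sup>2 - tr (A\<^sup>2)\<close>, \<open>d = (n - 2) \<rho>\<close> and \<open>c = t + d\<close>, so that \<open>\<tau> = s + d c\<close>.  The \<open>3 \<times> 3\<close>
  minors of a form of rank 2 vanish, and contracting them gives \<open>A \<and> A\<^sup>2 = (t/2) A \<and> A\<close>,
  \<open>A\<^sup>3 = t A\<^sup>2 - s A\<close> and \<open>A\<^sup>2 \<and> A\<^sup>2 = s A \<and> A\<close>.  For \<open>D = Ric(R*) - \<alpha>\<^sub>2 h = c A - A\<^sup>2\<close> this yields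
  \<open>D \<and> D = \<tau> A \<and> A\<close>, which decides the rank of \<open>D\<close>, and \<open>d \<tau> A = (d\<^sup>2 - s) D + D\<^sup>2\<close>, which
  expresses \<open>R* = (1/2) (A + \<rho> h) \<and> (A + \<rho> h)\<close> through \<open>h\<close>, \<open>D\<close> and \<open>D\<^sup>2\<close>.  If \<open>Ric(R*)\<close> is moreover
  quadratic over \<open>h\<close>, then \<open>D\<^sup>2 = l D\<close> and \<open>tr D = 2 l\<close>, and both sides of the last identity are
  combinations of \<open>D \<and> Q(h, D)\<close> and \<open>h \<and> Q(h, D)\<close>.
\<close>

section \<open>Symmetric forms on a scalar product space\<close>

text \<open>The geometric notions are definite descriptions: \<open>flat_deriv\<close> ranges over
  all parametrizations, \<open>affine_fundamental_form\<close> over all tangent fields. To evaluate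
  them, transition maps must be shown differentiable, and the normal part of the derivative of a
  tangent field must be shown to depend only on the value of the field at the point. Then both forms
  become normal components of second derivatives in one parametrization: \<open>h\<close> of those
  of the immersion, \<open>S\<close> up to sign of those of \<xi>, because the derivatives of \<xi>
  are tangent fields. Both symmetries are thus Schwarz's theorem. The constants come from expanding
  Ric(R): c and \<alpha>_2 are the coefficients of A and h, and \<tau> is c^2 - c t + s rewritten
  with c - t = d. The multiple of h \<and> h subtracted in B removes exactly the term \<alpha>_2 h,
  so Ric(B) = D. Rank 2 enters as a factorization A(x,y) = a(x) p(y) + b(x) q(y), which D inherits
  because only the first argument of A is altered.\<close>

definition linear_form_on :: "'v::real_vector set \<Rightarrow> ('v \<Rightarrow> real) \<Rightarrow> bool" where
  "linear_form_on V f \<longleftrightarrow>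
     (\<forall>x\<in>V. \<forall>y\<in>V. f (x + y) = f x + f y) \<and> (\<forall>x\<in>V. \<forall>c. f (c *\<^sub>R x) = c * f x)"

text \<open>Tensors are ambient functions controlled only on \<open>V\<close>, so symmetry and
  linearity are relative to \<open>V\<close>. Linearity is asked of the second argument; symmetry
  carries it to the first.\<close>

definition sym_form_on :: "'v::real_vector set \<Rightarrow> 'v tensor2 \<Rightarrow> bool" where
  "sym_form_on V A \<longleftrightarrow>
     (\<forall>x\<in>V. \<forall>y\<in>V. A x y = A y x) \<and> (\<forall>x\<in>V. linear_form_on V (A x))"

lemma linear_form_on_sum:
  assumes "subspace V" "linear_form_on V f" "finite I" "\<And>i. i \<in> I \<Longrightarrow> x i \<in> V"
  shows "f (\<Sum>i\<in>I. c i *\<^sub>R x i) = (\<Sum>i\<in>I. c i * f (x i))"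
  using assms(3,4)
proof (induction I rule: finite_induct)
  case empty
  have "f (0 *\<^sub>R 0) = 0 * f 0"
    using assms(1,2) subspace_0 unfolding linear_form_on_def by blast
  then show ?case by simp
next
  case (insert j I)
  have "(\<Sum>i\<in>I. c i *\<^sub>R x i) \<in> V"
    by (intro subspace_sum subspace_scale assms(1) insert.prems) auto
  then show ?case
    using insert assms(1,2) unfolding linear_form_on_def by (simp add: subspace_scale)
qed

lemma linear_form_on_0: "subspace V \<Longrightarrow> linear_form_on V f \<Longrightarrow> f 0 = 0"
  using linear_form_on_sum[of V f "{}"] by simp

lemma linear_form_on_add: "linear_form_on V f \<Longrightarrow> linear_form_on V g \<Longrightarrow> linear_form_on V (\<lambda>x. f x + g x)"
  and linear_form_on_diff: "linear_form_on V f \<Longrightarrow> linear_form_on V g \<Longrightarrow> linear_form_on V (\<lambda>x. f x - g x)"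
  and linear_form_on_cmult: "linear_form_on V f \<Longrightarrow> linear_form_on V (\<lambda>x. c * f x)"
  and linear_form_on_multc: "linear_form_on V f \<Longrightarrow> linear_form_on V (\<lambda>x. f x * c)"
  by (simp_all add: linear_form_on_def algebra_simps)

lemma sym_form_on_commute: "sym_form_on V A \<Longrightarrow> x \<in> V \<Longrightarrow> y \<in> V \<Longrightarrow> A x y = A y x"
  by (simp add: sym_form_on_def)

lemma sym_form_on_right: "sym_form_on V A \<Longrightarrow> x \<in> V \<Longrightarrow> linear_form_on V (A x)"
  by (simp add: sym_form_on_def)

lemma sym_form_on_left:
  assumes "subspace V" "sym_form_on V A" "y \<in> V"
  shows "linear_form_on V (\<lambda>x. A x y)"
  using assms unfolding sym_form_on_def linear_form_on_def by (simp add: subspace_add subspace_scale)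

locale scalar_product_space =
  fixes V :: "'n::finite affine_space set" and h :: "'n affine_space tensor2"
  assumes subspace_V: "subspace V" and dim_V: "dim V = CARD('n)" and sym_h: "sym_form_on V h"
    and nondegenerate: "\<And>x. x \<in> V \<Longrightarrow> (\<And>y. y \<in> V \<Longrightarrow> h x y = 0) \<Longrightarrow> x = 0"
begin

lemmas V_closed [simp, intro] = subspace_add[OF subspace_V] subspace_scale[OF subspace_V]
  subspace_diff[OF subspace_V] subspace_0[OF subspace_V] subspace_neg[OF subspace_V]

lemmas form_sum_right = linear_form_on_sum[OF subspace_V sym_form_on_right]
lemmas form_sum_left = linear_form_on_sum[OF subspace_V sym_form_on_left[OF subspace_V]]

lemma form_simps:
  assumes "sym_form_on V A" "x \<in> V" "y \<in> V" "z \<in> V"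
  shows "A (x + y) z = A x z + A y z" "A z (x + y) = A z x + A z y"
    "A (x - y) z = A x z - A y z" "A z (x - y) = A z x - A z y"
    "A (c *\<^sub>R x) z = c * A x z" "A z (c *\<^sub>R x) = c * A z x"
    "A 0 z = 0" "A z 0 = 0"
proof -
  have l: "linear_form_on V (\<lambda>x. A x z)" and r: "linear_form_on V (A z)"
    using sym_form_on_left[OF subspace_V assms(1,4)] sym_form_on_right[OF assms(1,4)] .
  show *: "A (x + y) z = A x z + A y z" "A z (x + y) = A z x + A z y"
    "A (c *\<^sub>R x) z = c * A x z" "A z (c *\<^sub>R x) = c * A z x"
    using l r assms unfolding linear_form_on_def by auto
  show "A 0 z = 0" "A z 0 = 0"
    using linear_form_on_0[OF subspace_V l] linear_form_on_0[OF subspace_V r] .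
  show "A (x - y) z = A x z - A y z" "A z (x - y) = A z x - A z y"
    using l r assms linear_form_on_sum[OF subspace_V l, of "{0,1::nat}" "\<lambda>i. if i = 0 then x else y" "\<lambda>i. if i = 0 then 1 else -1"]
      linear_form_on_sum[OF subspace_V r, of "{0,1::nat}" "\<lambda>i. if i = 0 then x else y" "\<lambda>i. if i = 0 then 1 else -1"]
    by auto
qed

text \<open>Stated for sets of any size, so that an orthonormal set can be enlarged and one of
  maximal cardinality chosen; the indexed family is recovered in
  \<open>orthonormal_basis_exists\<close>.\<close>

definition orthonormal :: "'n affine_space set \<Rightarrow> bool" where
  "orthonormal E \<longleftrightarrow> finite E \<and> E \<subseteq> V \<and> (\<forall>e\<in>E. h e e = 1 \<or> h e e = -1) \<and>
     (\<forall>e\<in>E. \<forall>f\<in>E. e \<noteq> f \<longrightarrow> h e f = 0)"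

lemma orthonormal_sum:
  assumes "orthonormal E" "e \<in> E"
  shows "h (\<Sum>f\<in>E. c f *\<^sub>R f) e = c e * h e e"
proof -
  have "h (\<Sum>f\<in>E. c f *\<^sub>R f) e = (\<Sum>f\<in>E. c f * h f e)"
    using assms by (intro form_sum_left[OF sym_h]) (auto simp: orthonormal_def)
  also have "\<dots> = (\<Sum>f\<in>E. if f = e then c e * h e e else 0)"
    using assms by (intro sum.cong) (auto simp: orthonormal_def)
  finally show ?thesis using assms by (simp add: orthonormal_def)
qed

lemma orthonormal_independent:
  assumes "orthonormal E"
  shows "independent E"
proof (rule independent_if_scalars_zero)
  show "finite E" using assms by (simp add: orthonormal_def)
  fix c e assume 0: "(\<Sum>f\<in>E. c f *\<^sub>R f) = 0" and e: "e \<in> E"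
  have "h 0 e = 0" using form_simps(7)[OF sym_h, of e e e] assms e by (auto simp: orthonormal_def)
  then have "c e * h e e = 0"
    using orthonormal_sum[OF assms e, of c] 0 by simp
  then show "c e = 0" using assms e unfolding orthonormal_def by fastforce
qed

text \<open>Orthogonal projection for an indefinite form: \<open>h f f\<close> is 1 or -1, hence its
  own inverse, so \<open>h f f * h x f\<close> is the quotient of \<open>h x f\<close> by
  \<open>h f f\<close>.\<close>

lemma orthonormal_remainder:
  assumes "orthonormal E" "x \<in> V"
  defines "x' \<equiv> x - (\<Sum>f\<in>E. (h f f * h x f) *\<^sub>R f)"
  shows "x' \<in> V" "\<And>e. e \<in> E \<Longrightarrow> h x' e = 0"
proof -
  have s: "(\<Sum>f\<in>E. (h f f * h x f) *\<^sub>R f) \<in> V"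
    using assms by (intro subspace_sum[OF subspace_V]) (auto simp: orthonormal_def)
  then show "x' \<in> V" using assms by auto
  fix e assume e: "e \<in> E"
  then have "e \<in> V" "h e e * h e e = 1" using assms(1) unfolding orthonormal_def by auto
  then show "h x' e = 0"
    unfolding x'_def form_simps(3)[OF sym_h \<open>x \<in> V\<close> s \<open>e \<in> V\<close>] orthonormal_sum[OF assms(1) e]
    by (simp add: mult_ac)
qed

lemma orthonormal_extend:
  assumes E: "orthonormal E" and w: "w \<in> V" "\<And>e. e \<in> E \<Longrightarrow> h w e = 0" "h w w \<noteq> 0"
  obtains e where "e \<notin> E" "orthonormal (insert e E)"
proof -
  define k where "k = 1 / sqrt \<bar>h w w\<bar>"
  have kk: "k * k * \<bar>h w w\<bar> = 1" using w(3) by (simp add: k_def)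
  have hkk: "h (k *\<^sub>R w) (k *\<^sub>R w) = k * k * h w w"
    using w(1) by (simp add: form_simps[OF sym_h])
  then have ee: "h (k *\<^sub>R w) (k *\<^sub>R w) = 1 \<or> h (k *\<^sub>R w) (k *\<^sub>R w) = -1"
    using kk by (cases "h w w > 0") auto
  have ef: "h (k *\<^sub>R w) e = 0" "h e (k *\<^sub>R w) = 0" if "e \<in> E" for e
  proof -
    have "e \<in> V" using that E by (auto simp: orthonormal_def)
    then show "h (k *\<^sub>R w) e = 0" "h e (k *\<^sub>R w) = 0"
      using w that sym_form_on_commute[OF sym_h _ w(1), of e] by (simp_all add: form_simps(5,6)[OF sym_h])
  qed
  show ?thesis
  proof (rule that)
    show "k *\<^sub>R w \<notin> E" using ee ef by fastforce
    show "orthonormal (insert (k *\<^sub>R w) E)"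
      using E ee ef w(1) unfolding orthonormal_def by auto
  qed
qed

lemma orthonormal_spanning_exists:
  obtains E where "orthonormal E" "span E = V"
proof -
  \<comment> \<open>The orthogonal complement of a maximal orthonormal set is isotropic, hence zero by polarization.\<close>
  have "orthonormal {}" by (simp add: orthonormal_def)
  moreover have "\<forall>E. orthonormal E \<longrightarrow> card E < CARD('n) + 1"
    using independent_card_le_dim[OF _ orthonormal_independent, of _ V] dim_V
    by (simp add: orthonormal_def less_Suc_eq_le)
  ultimately obtain E where E: "orthonormal E" and max: "\<And>E'. orthonormal E' \<Longrightarrow> card E' \<le> card E"
    using ex_has_greatest_nat[of orthonormal "{}" card "CARD('n) + 1"] by (metis less_imp_le)
  have isotropic: "h w w = 0" if w: "w \<in> V" "\<And>e. e \<in> E \<Longrightarrow> h w e = 0" for w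
  proof (rule ccontr)
    assume "h w w \<noteq> 0"
    then obtain e where "e \<notin> E" "orthonormal (insert e E)"
      using orthonormal_extend[OF E w] \<open>h w w \<noteq> 0\<close> by blast
    then show False
      using max[of "insert e E"] E by (simp add: orthonormal_def)
  qed
  have zero: "x = 0" if x: "x \<in> V" "\<And>e. e \<in> E \<Longrightarrow> h x e = 0" for x
  proof (rule nondegenerate[OF x(1)])
    fix y assume y: "y \<in> V"
    define s where "s = (\<Sum>f\<in>E. (h f f * h y f) *\<^sub>R f)"
    have s: "s \<in> V" unfolding s_def
      using E by (intro subspace_sum[OF subspace_V]) (auto simp: orthonormal_def)
    have y': "y - s \<in> V" "\<And>e. e \<in> E \<Longrightarrow> h (y - s) e = 0"
      unfolding s_def using orthonormal_remainder[OF E y] by auto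
    have "h (x + (y - s)) (x + (y - s)) = 0"
    proof (rule isotropic)
      show "x + (y - s) \<in> V" using x y' by blast
      fix e assume e: "e \<in> E"
      then have "e \<in> V" using E by (auto simp: orthonormal_def)
      then show "h (x + (y - s)) e = 0"
        using form_simps(1)[OF sym_h x(1) y'(1)] x(2)[OF e] y'(2)[OF e] by simp
    qed
    moreover have "h (x + (y - s)) (x + (y - s)) = h x x + 2 * h x (y - s) + h (y - s) (y - s)"
      using x(1) y'(1) sym_form_on_commute[OF sym_h x(1) y'(1)]
      by (simp add: form_simps(1,2)[OF sym_h])
    ultimately have "h x (y - s) = 0"
      using isotropic[OF x] isotropic[OF y'] by simp
    moreover have "h x s = 0"
      unfolding s_def using E x by (subst form_sum_right[OF sym_h x(1)]) (auto simp: orthonormal_def)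
    ultimately show "h x y = 0"
      using form_simps(4)[OF sym_h y s x(1)] by simp
  qed
  have "span E = V"
  proof
    show "span E \<subseteq> V" using E subspace_V by (simp add: orthonormal_def span_minimal)
    show "V \<subseteq> span E"
    proof
      fix x assume x: "x \<in> V"
      have "x = (\<Sum>f\<in>E. (h f f * h x f) *\<^sub>R f)"
        using zero[OF orthonormal_remainder[OF E x]] by simp
      also have "\<dots> \<in> span E" by (intro span_sum span_scale span_base)
      finally show "x \<in> span E" .
    qed
  qed
  with E show ?thesis by (rule that)
qed

lemma orthonormal_basis_exists: "\<exists>e. orthonormal_basis V h e"
proof -
  obtain E where E: "orthonormal E" "span E = V" by (rule orthonormal_spanning_exists)
  have "card E = CARD('n)"
    using dim_eq_card_independent[OF orthonormal_independent[OF E(1)]] dim_span[of E] E(2) dim_V by simp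
  then obtain e :: "'n \<Rightarrow> 'n affine_space" where e: "bij_betw e UNIV E"
    using E(1) finite_same_card_bij[of "UNIV :: 'n set" E] by (auto simp: orthonormal_def)
  then have "inj e" "range e = E" by (auto simp: bij_betw_def)
  then have "orthonormal_basis V h e"
    using E orthonormal_independent[OF E(1)]
    unfolding orthonormal_basis_def basis_of_def orthonormal_def by (auto simp: inj_eq)
  then show ?thesis by blast
qed

text \<open>The very basis over which \<open>Ric\<close> and \<open>scal\<close> sum, so that these
  become contractions by mere unfolding.\<close>

definition e :: "'n \<Rightarrow> 'n affine_space" where "e = some_onb V h"

definition \<epsilon> :: "'n \<Rightarrow> real" where "\<epsilon> j = h (e j) (e j)"

lemma onb: "orthonormal_basis V h e"
  unfolding e_def some_onb_def using orthonormal_basis_exists by (rule someI_ex)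

lemma e_in_V [simp, intro]: "e j \<in> V"
  using onb span_base[of "e j" "range e"] unfolding orthonormal_basis_def basis_of_def by auto

lemma orthonormal_e: "orthonormal (range e)"
  using onb unfolding orthonormal_basis_def orthonormal_def by auto metis

lemma h_e: "h (e i) (e j) = (if i = j then \<epsilon> j else 0)" and \<epsilon>_sq [simp]: "\<epsilon> j * \<epsilon> j = 1"
proof -
  show "h (e i) (e j) = (if i = j then \<epsilon> j else 0)"
    using onb unfolding orthonormal_basis_def \<epsilon>_def by simp
  have "\<epsilon> j = 1 \<or> \<epsilon> j = -1"
    using onb unfolding orthonormal_basis_def \<epsilon>_def by blast
  then show "\<epsilon> j * \<epsilon> j = 1" by auto
qed

lemma basis_some: "basis_of V (some_basis V)"
  unfolding some_basis_def using onb unfolding orthonormal_basis_def by (metis someI)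

lemma expand:
  assumes "x \<in> V"
  shows "x = (\<Sum>j\<in>UNIV. (\<epsilon> j * h x (e j)) *\<^sub>R e j)"
proof -
  define x' where "x' = x - (\<Sum>f\<in>range e. (h f f * h x f) *\<^sub>R f)"
  note x' = orthonormal_remainder[OF orthonormal_e assms, folded x'_def]
  have "x' = 0"
  proof (rule nondegenerate[OF x'(1)])
    fix y assume "y \<in> V"
    then have "y \<in> span (range e)" using onb by (simp add: orthonormal_basis_def basis_of_def)
    then have "y \<in> V \<and> h x' y = 0"
    proof (induction rule: span_induct)
      show "subspace {y. y \<in> V \<and> h x' y = 0}"
        unfolding subspace_def using x'(1) by (auto simp: form_simps[OF sym_h])
    qed (use x' in auto)
    then show "h x' y = 0" by simp
  qed
  moreover have "inj e" using onb by (simp add: orthonormal_basis_def basis_of_def)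
  ultimately show ?thesis
    unfolding x'_def by (simp add: sum.reindex \<epsilon>_def)
qed

lemma form_expand:
  assumes "linear_form_on V f" "x \<in> V"
  shows "f x = (\<Sum>j\<in>UNIV. \<epsilon> j * h x (e j) * f (e j))"
  by (rule trans[OF arg_cong[OF expand[OF assms(2)], of f]
        linear_form_on_sum[OF subspace_V assms(1), of UNIV e "\<lambda>j. \<epsilon> j * h x (e j)"]]) auto

text \<open>Guarantees that the descriptions in \<open>endo_of\<close> and \<open>curv_op\<close>
  denote. The witness is the expansion of the metric dual of \<open>f\<close> in the orthonormal
  basis; nondegeneracy gives uniqueness.\<close>

lemma riesz:
  assumes f: "linear_form_on V f"
  shows "\<exists>!w. w \<in> V \<and> (\<forall>y\<in>V. h w y = f y)"
proof (rule ex_ex1I)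
  let ?w = "\<Sum>j\<in>UNIV. (\<epsilon> j * f (e j)) *\<^sub>R e j"
  have "?w \<in> V" by (intro subspace_sum[OF subspace_V]) auto
  moreover have "h ?w y = f y" if "y \<in> V" for y
  proof -
    have "h ?w y = (\<Sum>j\<in>UNIV. \<epsilon> j * f (e j) * h (e j) y)"
      using that by (intro form_sum_left[OF sym_h]) auto
    also have "\<dots> = (\<Sum>j\<in>UNIV. \<epsilon> j * h y (e j) * f (e j))"
      using that by (intro sum.cong) (auto simp: sym_form_on_commute[OF sym_h, of y])
    finally show ?thesis using form_expand[OF f that] by simp
  qed
  ultimately show "\<exists>w. w \<in> V \<and> (\<forall>y\<in>V. h w y = f y)" by blast
next
  fix v w assume v: "v \<in> V \<and> (\<forall>y\<in>V. h v y = f y)" and w: "w \<in> V \<and> (\<forall>y\<in>V. h w y = f y)"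
  then have "v - w = 0"
    by (intro nondegenerate) (auto simp: form_simps(3)[OF sym_h])
  then show "v = w" by simp
qed

lemma endo_of:
  assumes "sym_form_on V A" "x \<in> V"
  shows "endo_of V h A x \<in> V" "y \<in> V \<Longrightarrow> h (endo_of V h A x) y = A x y"
  using theI'[OF riesz[OF sym_form_on_right[OF assms]]] unfolding endo_of_def by auto

lemma endo_of_unique:
  assumes "sym_form_on V A" "x \<in> V" "w \<in> V" "\<And>y. y \<in> V \<Longrightarrow> h w y = A x y"
  shows "endo_of V h A x = w"
  unfolding endo_of_def
  using assms by (intro the1_equality riesz[OF sym_form_on_right[OF assms(1,2)]]) auto

definition tr :: "'n affine_space tensor2 \<Rightarrow> real" where "tr A = (\<Sum>j\<in>UNIV. \<epsilon> j * A (e j) (e j))"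

text \<open>Composition of the associated endomorphisms, written as a contraction: this is the form
  in which it appears when a Ricci contraction is expanded.\<close>

definition prod2 :: "'n affine_space tensor2 \<Rightarrow> 'n affine_space tensor2 \<Rightarrow> 'n affine_space tensor2" where
  "prod2 A B x y = (\<Sum>j\<in>UNIV. \<epsilon> j * A x (e j) * B (e j) y)"

lemma prod2_eq:
  assumes A: "sym_form_on V A" and B: "sym_form_on V B" and "x \<in> V" "y \<in> V"
  shows "prod2 A B x y = B (endo_of V h A x) y"
  using form_expand[OF sym_form_on_left[OF subspace_V B \<open>y \<in> V\<close>] endo_of(1)[OF A \<open>x \<in> V\<close>]]
    endo_of(2)[OF A \<open>x \<in> V\<close>] unfolding prod2_def by simp

lemma sq2_eq_prod2:
  "sym_form_on V A \<Longrightarrow> x \<in> V \<Longrightarrow> y \<in> V \<Longrightarrow> sq2 V h A x y = prod2 A A x y"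
  by (simp add: sq2_def prod2_eq)

lemma sq2_eq_inner:
  assumes "sym_form_on V A" "x \<in> V" "y \<in> V"
  shows "sq2 V h A x y = h (endo_of V h A x) (endo_of V h A y)"
  using assms endo_of[OF assms(1)] sym_form_on_commute[OF assms(1)] sym_form_on_commute[OF sym_h]
  by (simp add: sq2_def)

lemma endo_of_linear:
  assumes "sym_form_on V A" "x \<in> V" "y \<in> V"
  shows "endo_of V h A (x + y) = endo_of V h A x + endo_of V h A y"
    "endo_of V h A (c *\<^sub>R x) = c *\<^sub>R endo_of V h A x"
  using assms endo_of[OF assms(1)]
  by (auto intro!: endo_of_unique simp: form_simps[OF sym_h] form_simps[OF assms(1)])

lemma sym_form_sq2:
  assumes "sym_form_on V A"
  shows "sym_form_on V (sq2 V h A)"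
  using assms endo_of(1)[OF assms] sym_form_on_commute[OF sym_h]
  unfolding sym_form_on_def linear_form_on_def
  by (auto simp: sq2_eq_inner[OF assms] endo_of_linear[OF assms] form_simps[OF sym_h])

text \<open>\<open>tr2\<close> is read off in \<open>some_basis\<close>, \<open>tr\<close> in the
  orthonormal basis. Expanding \<open>?L (?b i)\<close> in the \<open>e j\<close> and exchanging the
  sums, the coordinates of \<open>e j\<close> in \<open>?b\<close> reassemble \<open>e j\<close> in
  the first argument of \<open>A\<close>.\<close>

lemma tr2_eq_tr:
  assumes A: "sym_form_on V A"
  shows "tr2 V h A = tr A"
proof -
  let ?b = "some_basis V" and ?L = "endo_of V h A"
  let ?r = "representation (range ?b)"
  have b: "inj ?b" "independent (range ?b)" "span (range ?b) = V"
    using basis_some by (auto simp: basis_of_def)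
  have bV: "?b i \<in> V" for i using span_base[of "?b i" "range ?b"] b(3) by auto
  have LV: "?L x \<in> V" if "x \<in> V" for x using endo_of(1)[OF A that] .
  have "representation (range ?b) (?L (?b i)) (?b i) = (\<Sum>j\<in>UNIV. \<epsilon> j * A (?b i) (e j) * ?r (e j) (?b i))" for i
  proof -
    have "?r (?L (?b i)) = ?r (\<Sum>j\<in>UNIV. (\<epsilon> j * h (?L (?b i)) (e j)) *\<^sub>R e j)"
      by (rule arg_cong[OF expand[OF LV[OF bV]]])
    also have "\<dots> = (\<lambda>b. \<Sum>j\<in>UNIV. ?r ((\<epsilon> j * h (?L (?b i)) (e j)) *\<^sub>R e j) b)"
      using b by (intro representation_sum) auto
    finally show ?thesis
      using b bV by (simp add: representation_scale endo_of(2)[OF A])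
  qed
  then have "tr2 V h A = (\<Sum>i\<in>UNIV. \<Sum>j\<in>UNIV. \<epsilon> j * A (?b i) (e j) * ?r (e j) (?b i))"
    by (simp add: tr2_def endo_trace_def trace_def)
  also have "\<dots> = (\<Sum>j\<in>UNIV. \<Sum>i\<in>UNIV. \<epsilon> j * A (?b i) (e j) * ?r (e j) (?b i))"
    by (rule sum.swap)
  also have "\<dots> = (\<Sum>j\<in>UNIV. \<epsilon> j * A (e j) (e j))"
  proof (rule sum.cong[OF refl])
    fix j
    have "e j = (\<Sum>v\<in>range ?b. ?r (e j) v *\<^sub>R v)"
      using sum_representation_eq[of "range ?b" "e j" "range ?b"] b by simp
    also have "\<dots> = (\<Sum>i\<in>UNIV. ?r (e j) (?b i) *\<^sub>R ?b i)"
      using b(1) by (simp add: sum.reindex)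
    finally have "A (e j) (e j) = A (\<Sum>i\<in>UNIV. ?r (e j) (?b i) *\<^sub>R ?b i) (e j)"
      by (rule arg_cong[of _ _ "\<lambda>v. A v (e j)"])
    also have "\<dots> = (\<Sum>i\<in>UNIV. ?r (e j) (?b i) * A (?b i) (e j))"
      using bV by (intro form_sum_left[OF A]) auto
    finally show "(\<Sum>i\<in>UNIV. \<epsilon> j * A (?b i) (e j) * ?r (e j) (?b i)) = \<epsilon> j * A (e j) (e j)"
      by (simp add: sum_distrib_left mult_ac)
  qed
  finally show ?thesis by (simp add: tr_def)
qed

end

section \<open>Forms of rank at most two\<close>

text \<open>A basis of the row space is contained in a pair {r, s}. Choosing s = 0 when the rank is
  at most 1 lets the same decomposition serve both ranks.\<close>

lemma rows_in_span:
  fixes M :: "real^'n^'m"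
  assumes "rank M \<le> 2"
  obtains r s \<alpha> \<beta> where "\<And>i j. M $ i $ j = \<alpha> i * r $ j + \<beta> i * s $ j" "rank M \<le> 1 \<Longrightarrow> s = 0"
proof -
  obtain B where B: "B \<subseteq> rows M" "independent B" "rows M \<subseteq> span B" "card B = dim (rows M)"
    using basis_exists by metis
  have fin: "finite B" using B(2) by (rule independent_imp_finite)
  have card: "card B = rank M" using B(4) by (simp add: row_rank_def)
  obtain r s where rs: "B \<subseteq> {r, s}" "rank M \<le> 1 \<Longrightarrow> s = 0"
  proof (cases "rank M \<le> 1")
    case True
    then have "B = {} \<or> (\<exists>r. B = {r})"
      using card fin by (metis card_0_eq card_1_singletonE le_neq_implies_less less_one)
    then show ?thesis using that[of _ 0] by blast
  next
    case False
    then have "card B = 2" using card assms by simp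
    then show ?thesis using that False unfolding card_2_iff by blast
  qed
  have "\<exists>\<alpha> \<beta>. row i M = \<alpha> *\<^sub>R r + \<beta> *\<^sub>R s" for i
  proof -
    have "row i M \<in> span {r, s}"
      using B(3) span_mono[OF rs(1)] unfolding rows_def by blast
    then show ?thesis
      unfolding span_insert span_singleton by (auto simp: diff_eq_eq) (metis add.commute)
  qed
  then obtain \<alpha> \<beta> where ab: "\<And>i. row i M = \<alpha> i *\<^sub>R r + \<beta> i *\<^sub>R s" by metis
  have "M $ i $ j = \<alpha> i * r $ j + \<beta> i * s $ j" for i j
    using arg_cong[OF ab[of i], of "\<lambda>v. v $ j"] by (simp add: row_def)
  then show ?thesis using rs(2) by (rule that)
qed

context scalar_product_space
begin

lemma basis_expand:
  assumes "x \<in> V"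
  shows "x = (\<Sum>i\<in>UNIV. representation (range (some_basis V)) x (some_basis V i) *\<^sub>R some_basis V i)"
proof -
  have b: "inj (some_basis V)" "independent (range (some_basis V))" "span (range (some_basis V)) = V"
    using basis_some by (auto simp: basis_of_def)
  have "x = (\<Sum>v\<in>range (some_basis V). representation (range (some_basis V)) x v *\<^sub>R v)"
    using sum_representation_eq[of "range (some_basis V)" x "range (some_basis V)"] b assms by simp
  also have "\<dots> = (\<Sum>i\<in>UNIV. representation (range (some_basis V)) x (some_basis V i) *\<^sub>R some_basis V i)"
    using b(1) by (simp add: sum.reindex)
  finally show ?thesis .
qed

lemma some_basis_in_V [simp, intro]: "some_basis V i \<in> V"
  using basis_some span_base[of "some_basis V i" "range (some_basis V)"] by (auto simp: basis_of_def)

lemma form_basis_expand: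
  assumes A: "sym_form_on V A" and x: "x \<in> V" and y: "y \<in> V"
  defines "c \<equiv> \<lambda>x i. representation (range (some_basis V)) x (some_basis V i)"
  shows "A x y = (\<Sum>i\<in>UNIV. \<Sum>j\<in>UNIV. c x i * c y j * A (some_basis V i) (some_basis V j))"
proof -
  have "A x y = A (\<Sum>i\<in>UNIV. c x i *\<^sub>R some_basis V i) y"
    unfolding c_def by (rule arg_cong[OF basis_expand[OF x], of "\<lambda>x. A x y"])
  also have "\<dots> = (\<Sum>i\<in>UNIV. c x i * A (some_basis V i) y)"
    by (rule form_sum_left[OF A y]) auto
  also have "\<dots> = (\<Sum>i\<in>UNIV. c x i * A (some_basis V i) (\<Sum>j\<in>UNIV. c y j *\<^sub>R some_basis V j))"
    unfolding c_def
    by (rule arg_cong[OF basis_expand[OF y],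
          of "\<lambda>y. \<Sum>i\<in>UNIV. representation (range (some_basis V)) x (some_basis V i) * A (some_basis V i) y"])
  also have "\<dots> = (\<Sum>i\<in>UNIV. c x i * (\<Sum>j\<in>UNIV. c y j * A (some_basis V i) (some_basis V j)))"
    by (intro sum.cong refl arg_cong2[of _ _ _ _ "(*)"] form_sum_right[OF A]) auto
  finally show ?thesis by (simp add: sum_distrib_left mult.assoc)
qed

lemma form_rank_decomp:
  assumes A: "sym_form_on V A" and "form_rank V A \<le> 2"
  obtains a b p q where "\<And>x y. x \<in> V \<Longrightarrow> y \<in> V \<Longrightarrow> A x y = a x * p y + b x * q y"
    "\<And>y. form_rank V A \<le> 1 \<Longrightarrow> q y = 0"
proof -
  define c where "c x i = representation (range (some_basis V)) x (some_basis V i)" for x i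
  define M where "M = (\<chi> i j. A (some_basis V i) (some_basis V j))"
  have M: "form_rank V A = rank M" "M $ i $ j = A (some_basis V i) (some_basis V j)" for i j
    by (simp_all add: form_rank_def M_def)
  obtain r s \<alpha> \<beta> where "\<And>i j. M $ i $ j = \<alpha> i * r $ j + \<beta> i * s $ j" "rank M \<le> 1 \<Longrightarrow> s = 0"
    using rows_in_span[of M] assms(2) unfolding M(1) by metis
  then have rs: "\<And>i j. A (some_basis V i) (some_basis V j) = \<alpha> i * r $ j + \<beta> i * s $ j"
    "form_rank V A \<le> 1 \<Longrightarrow> s = 0"
    by (simp_all add: M)
  show ?thesis
  proof (rule that)
    fix x y assume xy: "x \<in> V" "y \<in> V"
    have "A x y = (\<Sum>i\<in>UNIV. \<Sum>j\<in>UNIV. c x i * c y j * A (some_basis V i) (some_basis V j))"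
      unfolding c_def by (rule form_basis_expand[OF A xy])
    also have "\<dots> = (\<Sum>i\<in>UNIV. \<Sum>j\<in>UNIV. (c x i * \<alpha> i) * (c y j * r $ j) + (c x i * \<beta> i) * (c y j * s $ j))"
      by (simp add: rs algebra_simps)
    also have "\<dots> = (\<Sum>i\<in>UNIV. c x i * \<alpha> i) * (\<Sum>j\<in>UNIV. c y j * r $ j)
        + (\<Sum>i\<in>UNIV. c x i * \<beta> i) * (\<Sum>j\<in>UNIV. c y j * s $ j)"
      by (simp only: sum.distrib sum_product)
    finally show "A x y = (\<Sum>i\<in>UNIV. c x i * \<alpha> i) * (\<Sum>j\<in>UNIV. c y j * r $ j)
        + (\<Sum>i\<in>UNIV. c x i * \<beta> i) * (\<Sum>j\<in>UNIV. c y j * s $ j)" .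
  qed (simp add: rs(2))
qed

text \<open>For the converse, the vanishing 2 x 2 minors through a nonzero entry of the Gram matrix
  make every row a multiple of the row of that entry.\<close>

lemma form_rank_le_1_iff:
  assumes A: "sym_form_on V A"
  shows "form_rank V A \<le> 1 \<longleftrightarrow>
    (\<forall>x1\<in>V. \<forall>x2\<in>V. \<forall>y1\<in>V. \<forall>y2\<in>V. A x1 y1 * A x2 y2 = A x1 y2 * A x2 y1)" (is "_ \<longleftrightarrow> ?minors")
proof
  assume *: "form_rank V A \<le> 1"
  then have "form_rank V A \<le> 2" by simp
  from form_rank_decomp[OF A this] obtain a b p q
    where "\<And>x y. x \<in> V \<Longrightarrow> y \<in> V \<Longrightarrow> A x y = a x * p y + b x * q y" "\<And>y. q y = 0"
    using * by metis
  then show ?minors by simp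
next
  assume minors: ?minors
  define M where "M = (\<chi> i j. A (some_basis V i) (some_basis V j))"
  have m: "M $ i $ j * M $ k $ l = M $ i $ l * M $ k $ j" for i j k l
    using minors by (simp add: M_def)
  obtain i where i: "\<And>k. \<exists>c. row k M = c *\<^sub>R row i M"
  proof (cases "M = 0")
    case True
    then show ?thesis
      by (intro that[of undefined]) (auto simp: row_def vec_eq_iff)
  next
    case False
    then obtain i j where ij: "M $ i $ j \<noteq> 0" by (auto simp: vec_eq_iff)
    have "row k M = (M $ k $ j / M $ i $ j) *\<^sub>R row i M" for k
      using m[of i j k] ij by (simp add: vec_eq_iff row_def field_simps)
    then show ?thesis using that by blast
  qed
  have "rows M \<subseteq> span {row i M}"
    using i unfolding rows_def span_singleton by auto
  then have "dim (rows M) \<le> card {row i M}" by (intro dim_le_card) auto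
  then show "form_rank V A \<le> 1"
    by (simp add: form_rank_def row_rank_def M_def)
qed

text \<open>\<open>KN A A\<close> is twice a 2 x 2 minor of \<open>A\<close>. This turns the rank
  statements about D into identities between Kulkarni-Nomizu products.\<close>

lemma KN_zero_iff_form_rank_le_1:
  assumes A: "sym_form_on V A"
  shows "form_rank V A \<le> 1 \<longleftrightarrow> (\<forall>x1\<in>V. \<forall>x2\<in>V. \<forall>x3\<in>V. \<forall>x4\<in>V. KN A A x1 x2 x3 x4 = 0)"
proof -
  have "KN A A x1 x2 x3 x4 = 0 \<longleftrightarrow> A x1 x4 * A x2 x3 = A x1 x3 * A x2 x4" for x1 x2 x3 x4
    unfolding KN_def by (auto simp: mult.commute)
  then show ?thesis unfolding form_rank_le_1_iff[OF A] by blast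
qed

text \<open>Rank at most 2, expressed by arbitrary functions as factors. This is all that the 3 x 3
  minors ask for, and it survives replacing x by a function of x, as in A^2.\<close>

definition two_term :: "'n affine_space tensor2 \<Rightarrow> bool" where
  "two_term A \<longleftrightarrow> (\<exists>a b p q. \<forall>x\<in>V. \<forall>y\<in>V. A x y = a x * p y + b x * q y)"

lemma two_term_minor:
  assumes "two_term A" "x1 \<in> V" "x2 \<in> V" "x3 \<in> V" "y1 \<in> V" "y2 \<in> V" "y3 \<in> V"
  shows "A x1 y1 * (A x2 y2 * A x3 y3 - A x2 y3 * A x3 y2)
    - A x1 y2 * (A x2 y1 * A x3 y3 - A x2 y3 * A x3 y1)
    + A x1 y3 * (A x2 y1 * A x3 y2 - A x2 y2 * A x3 y1) = 0"
proof -
  obtain a b p q where "\<And>x y. x \<in> V \<Longrightarrow> y \<in> V \<Longrightarrow> A x y = a x * p y + b x * q y"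
    using assms(1) unfolding two_term_def by blast
  then show ?thesis using assms by (simp add: algebra_simps)
qed

lemma KN_sq2:
  assumes A: "sym_form_on V A" "two_term A" and x: "x1 \<in> V" "x2 \<in> V" "x3 \<in> V" "x4 \<in> V"
  shows "KN A (sq2 V h A) x1 x2 x3 x4 = tr A / 2 * KN A A x1 x2 x3 x4"
proof -
  \<comment> \<open>contraction of a \<open>3 \<times> 3\<close> minor over its last row and column\<close>
  have "0 = (\<Sum>j\<in>UNIV. \<epsilon> j * (A x1 x4 * (A x2 x3 * A (e j) (e j) - A x2 (e j) * A (e j) x3)
    - A x1 x3 * (A x2 x4 * A (e j) (e j) - A x2 (e j) * A (e j) x4)
    + A x1 (e j) * (A x2 x4 * A (e j) x3 - A x2 x3 * A (e j) x4)))"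
    using two_term_minor[OF A(2) x(1,2) e_in_V x(4,3) e_in_V] by simp
  also have "\<dots> = A x1 x4 * (A x2 x3 * tr A - prod2 A A x2 x3)
    - A x1 x3 * (A x2 x4 * tr A - prod2 A A x2 x4)
    + (A x2 x4 * prod2 A A x1 x3 - A x2 x3 * prod2 A A x1 x4)"
    by (simp add: tr_def prod2_def algebra_simps sum.distrib sum_subtractf sum_distrib_left)
  finally show ?thesis
    using x by (simp add: KN_def sq2_eq_prod2[OF A(1)] algebra_simps)
qed

section \<open>Ricci contractions of Kulkarni-Nomizu products and the relations of a form of rank at
  most 2\<close>

lemma Ric_eq: "Ric V h T x y = (\<Sum>j\<in>UNIV. \<epsilon> j * T (e j) x y (e j))"
  by (simp add: Ric_def e_def \<epsilon>_def Let_def)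

lemma scal_eq: "scal V h T = tr (Ric V h T)"
  by (simp add: scal_def tr_def e_def \<epsilon>_def Let_def)

lemma Ric_KN: "Ric V h (KN E F) x y = tr E * F x y + tr F * E x y - prod2 E F x y - prod2 F E x y"
  by (simp add: Ric_eq KN_def tr_def prod2_def algebra_simps sum.distrib sum_subtractf sum_distrib_left)

lemma Ric_cong:
  assumes "\<And>x1 x2 x3 x4. x1 \<in> V \<Longrightarrow> x2 \<in> V \<Longrightarrow> x3 \<in> V \<Longrightarrow> x4 \<in> V \<Longrightarrow> T x1 x2 x3 x4 = T' x1 x2 x3 x4"
    and "x \<in> V" "y \<in> V"
  shows "Ric V h T x y = Ric V h T' x y"
  using assms by (simp add: Ric_eq)

lemma Ric_cmult: "Ric V h (\<lambda>x1 x2 x3 x4. c * T x1 x2 x3 x4) x y = c * Ric V h T x y"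
  by (simp add: Ric_eq sum_distrib_left mult_ac)

lemma Ric_diff: "Ric V h (\<lambda>x1 x2 x3 x4. T x1 x2 x3 x4 - U x1 x2 x3 x4) x y = Ric V h T x y - Ric V h U x y"
  by (simp add: Ric_eq right_diff_distrib sum_subtractf)

lemma tr_cong: "(\<And>x y. x \<in> V \<Longrightarrow> y \<in> V \<Longrightarrow> A x y = A' x y) \<Longrightarrow> tr A = tr A'"
  by (simp add: tr_def)

lemma tr_linear: "tr (\<lambda>x y. a * A x y + b * B x y) = a * tr A + b * tr B"
  by (simp add: tr_def algebra_simps sum.distrib sum_distrib_left)

lemma tr_h: "tr h = real CARD('n)"
  by (simp add: tr_def h_e)

lemma prod2_h:
  assumes A: "sym_form_on V A" and "x \<in> V" "y \<in> V"
  shows "prod2 A h x y = A x y" "prod2 h A x y = A x y"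
proof -
  show "prod2 A h x y = A x y"
    using prod2_eq[OF A sym_h assms(2,3)] endo_of(2)[OF A assms(2,3)] by simp
  have "endo_of V h h x = x" using assms(2) by (intro endo_of_unique[OF sym_h]) auto
  then show "prod2 h A x y = A x y"
    using prod2_eq[OF sym_h A assms(2,3)] by simp
qed

text \<open>The Cayley-Hamilton relation in rank at most 2, obtained by applying \<open>Ric\<close>
  to \<open>KN_sq2\<close>: the left side contracts to t A^2 + tr(A^2) A - 2 A^3, the right side to
  t (t A - A^2).\<close>

lemma sq2_cubic:
  assumes A: "sym_form_on V A" "two_term A" and x: "x \<in> V" "y \<in> V"
  shows "sq2 V h A (endo_of V h A x) y =
    tr A * sq2 V h A x y - ((tr A)\<^sup>2 - tr (sq2 V h A)) / 2 * A x y"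
proof -
  note A2 = sym_form_sq2[OF A(1)]
  have endo: "endo_of V h A x \<in> V" "endo_of V h A y \<in> V" using x endo_of(1)[OF A(1)] by auto
  \<comment> \<open>Both mixed contractions, of A with A^2 and of A^2 with A, reduce to
    \<open>A\<close> evaluated at the images of x and y, so they agree and together give the term 2
    A^3.\<close>
  have inner: "sq2 V h A (endo_of V h A x) y = A (endo_of V h A x) (endo_of V h A y)"
    "sq2 V h A (endo_of V h A y) x = A (endo_of V h A y) (endo_of V h A x)"
    using sq2_eq_inner[OF A(1) endo(1) x(2)] sq2_eq_inner[OF A(1) endo(2) x(1)]
      endo_of(2)[OF A(1) endo(1) endo(2)] endo_of(2)[OF A(1) endo(2) endo(1)] by simp_all
  have "prod2 A (sq2 V h A) x y = sq2 V h A (endo_of V h A x) y"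
    by (rule prod2_eq[OF A(1) A2 x])
  moreover have "prod2 (sq2 V h A) A x y = prod2 A (sq2 V h A) y x"
    unfolding prod2_def using x
    by (intro sum.cong refl) (simp add: sym_form_on_commute[OF A(1), of _ y] sym_form_on_commute[OF A2, of x])
  moreover have "prod2 A (sq2 V h A) y x = sq2 V h A (endo_of V h A y) x"
    by (rule prod2_eq[OF A(1) A2 x(2,1)])
  moreover have "A (endo_of V h A y) (endo_of V h A x) = A (endo_of V h A x) (endo_of V h A y)"
    by (rule sym_form_on_commute[OF A(1) endo(2,1)])
  ultimately have "Ric V h (KN A (sq2 V h A)) x y =
      tr A * sq2 V h A x y + tr (sq2 V h A) * A x y - 2 * sq2 V h A (endo_of V h A x) y"
    by (simp add: Ric_KN inner)
  moreover have "Ric V h (KN A (sq2 V h A)) x y = tr A / 2 * Ric V h (KN A A) x y"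
    unfolding Ric_cmult[symmetric] using KN_sq2[OF A] x by (intro Ric_cong) auto
  moreover have "Ric V h (KN A A) x y = 2 * (tr A * A x y - sq2 V h A x y)"
    using x by (simp add: Ric_KN sq2_eq_prod2[OF A(1)])
  ultimately show ?thesis by (simp add: field_simps power2_eq_square)
qed

text \<open>\<open>KN_sq2\<close> with \<open>x1\<close> replaced by its image under the
  endomorphism of \<open>A\<close>: this raises the power in every factor containing
  \<open>x1\<close>, the cubes are reduced by \<open>sq2_cubic\<close>, and the terms with tr A
  cancel.\<close>

lemma KN_sq2_sq2:
  assumes A: "sym_form_on V A" "two_term A" and x: "x1 \<in> V" "x2 \<in> V" "x3 \<in> V" "x4 \<in> V"
  shows "KN (sq2 V h A) (sq2 V h A) x1 x2 x3 x4 = ((tr A)\<^sup>2 - tr (sq2 V h A)) / 2 * KN A A x1 x2 x3 x4"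
proof -
  let ?L = "endo_of V h A"
  have L: "?L x1 \<in> V" using endo_of(1)[OF A(1) x(1)] .
  have "A (?L x1) y = sq2 V h A x1 y" for y by (simp add: sq2_def)
  then show ?thesis
    using KN_sq2[OF A L x(2-4)] sq2_cubic[OF A x(1) x(3)] sq2_cubic[OF A x(1) x(4)]
    unfolding KN_def by (simp add: field_simps)
qed

lemma sym_form_cong:
  assumes "sym_form_on V A" "\<And>x y. x \<in> V \<Longrightarrow> y \<in> V \<Longrightarrow> A' x y = A x y"
  shows "sym_form_on V A'"
  using assms unfolding sym_form_on_def linear_form_on_def by (simp add: subspace_add subspace_scale)

lemma sym_form_lincomb:
  assumes "sym_form_on V A" "sym_form_on V B"
  shows "sym_form_on V (\<lambda>x y. a * A x y + b * B x y)"
  using assms unfolding sym_form_on_def linear_form_on_def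
  by (simp add: algebra_simps)

text \<open>The same \<open>p\<close> and \<open>q\<close> serve, since only the first argument is
  transformed.\<close>

lemma two_term_endo:
  assumes A: "sym_form_on V A" "two_term A"
    and D: "\<And>x y. x \<in> V \<Longrightarrow> y \<in> V \<Longrightarrow> D x y = c * A x y + k * A (endo_of V h A x) y"
  shows "two_term D"
proof -
  obtain a b p q where ab: "\<And>x y. x \<in> V \<Longrightarrow> y \<in> V \<Longrightarrow> A x y = a x * p y + b x * q y"
    using A(2) unfolding two_term_def by blast
  have "D x y = (c * a x + k * a (endo_of V h A x)) * p y + (c * b x + k * b (endo_of V h A x)) * q y"
    if "x \<in> V" "y \<in> V" for x y
    unfolding D[OF that] ab[OF that] ab[OF endo_of(1)[OF A(1) that(1)] that(2)] by (simp add: algebra_simps)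
  then show ?thesis
    unfolding two_term_def
    by (intro exI[of _ p] exI[of _ q] exI[of _ "\<lambda>x. c * a x + k * a (endo_of V h A x)"]
        exI[of _ "\<lambda>x. c * b x + k * b (endo_of V h A x)"]) simp
qed

text \<open>At three different vectors of the orthonormal basis the 3 x 3 minor of \<mu> h is
  \<mu>^3 up to sign.\<close>

lemma two_term_multiple_of_h:
  assumes "two_term A" "\<And>x y. x \<in> V \<Longrightarrow> y \<in> V \<Longrightarrow> A x y = \<mu> * h x y" "CARD('n) \<ge> 3"
  shows "\<mu> = 0"
proof -
  obtain I :: "'n set" where "card I = 3"
    using obtain_subset_with_card_n[OF assms(3)] by blast
  then obtain i j k :: 'n where ijk: "i \<noteq> j" "i \<noteq> k" "j \<noteq> k"
    unfolding card_3_iff by blast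
  have "\<mu> * \<epsilon> i * (\<mu> * \<epsilon> j * (\<mu> * \<epsilon> k)) = 0"
    using two_term_minor[OF assms(1), of "e i" "e j" "e k" "e i" "e j" "e k"] ijk
    by (simp add: assms(2) h_e)
  moreover have "\<epsilon> l \<noteq> 0" for l using \<epsilon>_sq[of l] by (metis mult_zero_left zero_neq_one)
  ultimately show ?thesis by simp
qed

end

section \<open>The curvature identities at a point\<close>

text \<open>The data of the theorem at a single point. Derived tensors are parameters fixed by
  equations, so that the fields of the theorem, evaluated at the point, form an instance
  directly.\<close>

locale quasi_umbilical_form = scalar_product_space V h
  for V :: "'n::finite affine_space set" and h +
  fixes S A D :: "'n affine_space tensor2" and R B :: "'n affine_space tensor4" and \<rho> n \<alpha> \<tau> :: real
  assumes sym_S: "sym_form_on V S" and four_le: "CARD('n) \<ge> 4" and n_def: "n = real CARD('n)"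
    and A_def: "A = sub_smult S \<rho> h" and rank_two: "form_rank V A = 2"
    and \<alpha>_def: "\<alpha> = \<rho> * (tr2 V h A + (n - 1) * \<rho>)"
    and \<tau>_def: "\<tau> = 1 / 2 * ((tr2 V h A)\<^sup>2 - tr2 V h (sq2 V h A)) + (n - 2) * \<rho> * (tr2 V h A + (n - 2) * \<rho>)"
    and R_def: "R = (\<lambda>X1 X2 X3 X4. 1 / 2 * KN S S X1 X2 X3 X4)"
    and D_def: "D = sub_smult (Ric V h R) \<alpha> h"
    and B_def: "B = (\<lambda>X1 X2 X3 X4. R X1 X2 X3 X4 - \<alpha> / (2 * (n - 1)) * KN h h X1 X2 X3 X4)"
begin

abbreviation "A2 \<equiv> sq2 V h A"

definition t :: real where "t = tr A"

text \<open>The second elementary symmetric function of the eigenvalues of the endomorphism of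
  \<open>A\<close>.\<close>

definition s :: real where "s = ((tr A)\<^sup>2 - tr A2) / 2"

definition d :: real where "d = (n - 2) * \<rho>"

definition c :: real where "c = t + d"

lemma n_ge: "n \<ge> 4"
  using four_le n_def by simp

lemma S_eq: "S x y = A x y + \<rho> * h x y"
  by (simp add: A_def sub_smult_def)

lemma sym_A: "sym_form_on V A"
  using sym_form_lincomb[OF sym_S sym_h, of 1 "- \<rho>"] by (simp add: A_def sub_smult_def[abs_def])

lemmas sym_A2 = sym_form_sq2[OF sym_A]

lemma two_term_A: "two_term A"
  using form_rank_decomp[OF sym_A] rank_two unfolding two_term_def by (metis order_refl)

lemma tr2_A: "tr2 V h A = t" "tr2 V h A2 = t\<^sup>2 - 2 * s"
  by (simp_all add: tr2_eq_tr sym_A sym_A2 t_def s_def diff_divide_distrib)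

lemma tr_A2: "tr A2 = t\<^sup>2 - 2 * s"
  by (simp add: t_def s_def diff_divide_distrib)

lemma \<tau>_eq: "\<tau> = s + d * c"
  by (simp add: \<tau>_def tr2_A d_def c_def algebra_simps)

lemma KN_A2:
  assumes "x1 \<in> V" "x2 \<in> V" "x3 \<in> V" "x4 \<in> V"
  shows "KN A A2 x1 x2 x3 x4 = t / 2 * KN A A x1 x2 x3 x4" "KN A2 A2 x1 x2 x3 x4 = s * KN A A x1 x2 x3 x4"
  using KN_sq2[OF sym_A two_term_A assms] KN_sq2_sq2[OF sym_A two_term_A assms]
  by (simp_all only: t_def s_def)

lemma cubic:
  assumes "x \<in> V" "y \<in> V"
  shows "A2 (endo_of V h A x) y = t * A2 x y - s * A x y"
  using sq2_cubic[OF sym_A two_term_A assms] by (simp only: t_def s_def)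

lemma Ric_h: "x \<in> V \<Longrightarrow> y \<in> V \<Longrightarrow> Ric V h (KN h h) x y = 2 * (n - 1) * h x y"
  by (simp add: Ric_KN tr_h[folded n_def] prod2_h[OF sym_h] algebra_simps)

text \<open>Ric(R) is (tr S) S - S^2. With S = A + \<rho> h and tr S = t + n \<rho>, the coefficient
  of A is t + (n - 2) \<rho> = c, and that of h is \<rho> (t + n \<rho>) - \<rho>^2 =
  \<alpha>.\<close>

lemma Ric_R:
  assumes "x \<in> V" "y \<in> V"
  shows "Ric V h R x y = c * A x y - A2 x y + \<alpha> * h x y"
proof -
  have tr_S: "tr S = t + \<rho> * n"
  proof -
    have "tr S = tr (\<lambda>x y. 1 * A x y + \<rho> * h x y)"
      by (rule tr_cong) (simp add: S_eq)
    then show ?thesis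
      unfolding tr_linear tr_h[folded n_def] t_def by simp
  qed
  have "prod2 S S x y = prod2 A A x y + \<rho> * prod2 A h x y + \<rho> * prod2 h A x y + \<rho>\<^sup>2 * prod2 h h x y"
    unfolding prod2_def S_eq
    by (simp add: algebra_simps sum.distrib sum_distrib_left power2_eq_square)
  then have "prod2 S S x y = A2 x y + 2 * \<rho> * A x y + \<rho>\<^sup>2 * h x y"
    using assms by (simp add: prod2_h sym_A sym_h sq2_eq_prod2)
  then have "Ric V h R x y = (t + \<rho> * n) * (A x y + \<rho> * h x y) - (A2 x y + 2 * \<rho> * A x y + \<rho>\<^sup>2 * h x y)"
    unfolding R_def Ric_cmult Ric_KN tr_S S_eq[of x y] by simp
  then show ?thesis
    by (simp add: \<alpha>_def tr2_A c_def d_def algebra_simps power2_eq_square)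
qed

lemma D_eq: "x \<in> V \<Longrightarrow> y \<in> V \<Longrightarrow> D x y = c * A x y - A2 x y"
  by (simp add: D_def sub_smult_def Ric_R)

lemma sym_D: "sym_form_on V D"
  by (rule sym_form_cong[OF sym_form_lincomb[OF sym_A sym_A2, of c "-1"]]) (simp add: D_eq)

lemma sym_Ric_R: "sym_form_on V (Ric V h R)"
  by (rule sym_form_cong[OF sym_form_lincomb[OF sym_D sym_h, of 1 "\<alpha>"]]) (simp add: D_def sub_smult_def)

text \<open>Expanding D = c A - A^2 by \<open>KN_A2\<close> leaves the factor c^2 - c t + s = c d +
  s.\<close>

lemma KN_D:
  assumes "x1 \<in> V" "x2 \<in> V" "x3 \<in> V" "x4 \<in> V"
  shows "KN D D x1 x2 x3 x4 = \<tau> * KN A A x1 x2 x3 x4"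
proof -
  have "KN D D x1 x2 x3 x4 = c\<^sup>2 * KN A A x1 x2 x3 x4 - 2 * c * KN A A2 x1 x2 x3 x4 + KN A2 A2 x1 x2 x3 x4"
    unfolding KN_def using assms by (simp only: D_eq) algebra
  then show ?thesis
    unfolding KN_A2[OF assms] \<tau>_eq c_def by (simp add: field_simps power2_eq_square)
qed

lemma endo_of_D:
  assumes "x \<in> V"
  shows "endo_of V h D x = c *\<^sub>R endo_of V h A x - endo_of V h A (endo_of V h A x)"
proof (rule endo_of_unique[OF sym_D assms])
  have L: "endo_of V h A x \<in> V" "endo_of V h A (endo_of V h A x) \<in> V"
    using endo_of(1)[OF sym_A] assms by auto
  then show "c *\<^sub>R endo_of V h A x - endo_of V h A (endo_of V h A x) \<in> V" by auto
  fix y assume y: "y \<in> V"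
  show "h (c *\<^sub>R endo_of V h A x - endo_of V h A (endo_of V h A x)) y = D x y"
    unfolding D_eq[OF assms y] using L y assms
    by (simp add: form_simps(3,5)[OF sym_h] endo_of(2)[OF sym_A] sq2_def)
qed

text \<open>Solves D = c A - A^2 for A. The cubic relation reduces D^2 to (d^2 - s) A^2 + (2 c - t)
  s A; adding (d^2 - s) D cancels A^2, and the remaining coefficient of A is d (s + d c).\<close>

lemma sq2_D:
  assumes "x \<in> V" "y \<in> V"
  shows "sq2 V h D x y + (d\<^sup>2 - s) * D x y = d * \<tau> * A x y"
proof -
  let ?L = "endo_of V h A"
  have L: "?L x \<in> V" "?L (?L x) \<in> V"
    using endo_of(1)[OF sym_A] assms by auto
  have "sq2 V h D x y = c * D (?L x) y - D (?L (?L x)) y"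
    unfolding sq2_def[of V h D] endo_of_D[OF assms(1)] using L assms
    by (simp only: form_simps(3,5)[OF sym_D] V_closed)
  also have "\<dots> = c * (c * A2 x y - A2 (?L x) y) - (c * A2 (?L x) y - A2 (?L (?L x)) y)"
    using L assms by (simp only: D_eq) (simp add: sq2_def)
  also have "A2 (?L (?L x)) y = t * A2 (?L x) y - s * A2 x y"
    using cubic[OF L(1) assms(2)] by (simp add: sq2_def)
  finally show ?thesis
    unfolding cubic[OF assms] D_eq[OF assms] \<tau>_eq c_def by algebra
qed

lemma tr_D: "tr D = d * t + 2 * s"
proof -
  have "tr D = tr (\<lambda>x y. c * A x y + (-1) * A2 x y)"
    by (rule tr_cong) (simp add: D_eq)
  also have "\<dots> = c * t + (-1) * (t\<^sup>2 - 2 * s)"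
    unfolding tr_linear tr_A2 t_def[symmetric] ..
  finally show ?thesis by (simp add: c_def algebra_simps power2_eq_square)
qed

lemma tr_sq2_D: "tr (sq2 V h D) = (tr D)\<^sup>2 - 2 * s * \<tau>"
proof -
  have "tr (sq2 V h D) = tr (\<lambda>x y. d * \<tau> * A x y + (s - d\<^sup>2) * D x y)"
  proof (rule tr_cong)
    fix x y assume "x \<in> V" "y \<in> V"
    from sq2_D[OF this] show "sq2 V h D x y = d * \<tau> * A x y + (s - d\<^sup>2) * D x y"
      by algebra
  qed
  also have "\<dots> = d * \<tau> * t + (s - d\<^sup>2) * tr D"
    unfolding tr_linear t_def[symmetric] ..
  finally show ?thesis unfolding tr_D \<tau>_eq c_def by algebra
qed

text \<open>The origin of the constant in \<open>B\<close>: Ric(h \<and> h) = 2 (n - 1) h, so the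
  subtracted term takes \<alpha> h away from Ric(R).\<close>

lemma Ric_B: "x \<in> V \<Longrightarrow> y \<in> V \<Longrightarrow> Ric V h B x y = D x y"
  unfolding B_def Ric_diff Ric_cmult
  using n_ge by (simp add: Ric_h D_def sub_smult_def)

lemma scal_R: "scal V h R = tr D + n * \<alpha>"
proof -
  have "tr D = tr (\<lambda>x y. 1 * Ric V h R x y + (- \<alpha>) * h x y)"
    by (rule tr_cong) (simp add: D_def sub_smult_def)
  then show ?thesis unfolding tr_linear tr_h[folded n_def] scal_eq by simp
qed

lemma scal_B: "scal V h B = tr D"
  unfolding scal_eq by (rule tr_cong[OF Ric_B])

lemma sq2_Ric_B:
  assumes "x \<in> V" "y \<in> V"
  shows "sq2 V h (Ric V h B) x y = sq2 V h D x y"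
proof -
  have sym_B: "sym_form_on V (Ric V h B)" by (rule sym_form_cong[OF sym_D Ric_B])
  have "endo_of V h (Ric V h B) x = endo_of V h D x"
    by (rule endo_of_unique[OF sym_B assms(1) endo_of(1)[OF sym_D assms(1)]])
      (simp only: endo_of(2)[OF sym_D assms(1)] Ric_B[OF assms(1)])
  then show ?thesis
    unfolding sq2_def[of V h "Ric V h B"] sq2_def[of V h D]
    using Ric_B[OF endo_of(1)[OF sym_D assms(1)] assms(2)] by simp
qed

lemma tr2_sq2_Ric_B: "tr2 V h (sq2 V h (Ric V h B)) = tr (sq2 V h D)"
proof -
  have "sym_form_on V (sq2 V h (Ric V h B))"
    by (rule sym_form_cong[OF sym_form_sq2[OF sym_D] sq2_Ric_B])
  then have "tr2 V h (sq2 V h (Ric V h B)) = tr (sq2 V h (Ric V h B))"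
    by (rule tr2_eq_tr)
  also have "\<dots> = tr (sq2 V h D)" by (rule tr_cong[OF sq2_Ric_B])
  finally show ?thesis .
qed

lemma rank_D_le_1:
  assumes "\<tau> = 0"
  shows "form_rank V D \<le> 1"
  unfolding KN_zero_iff_form_rank_le_1[OF sym_D] using KN_D assms by simp

lemma rank_D_ge_2:
  assumes "\<tau> \<noteq> 0"
  shows "form_rank V D \<ge> 2"
proof (rule ccontr)
  assume "\<not> form_rank V D \<ge> 2"
  then have "form_rank V D \<le> 1" by simp
  then have "\<forall>x1\<in>V. \<forall>x2\<in>V. \<forall>x3\<in>V. \<forall>x4\<in>V. KN A A x1 x2 x3 x4 = 0"
    unfolding KN_zero_iff_form_rank_le_1[OF sym_D] using KN_D assms by (metis mult_eq_0_iff)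
  then have "form_rank V A \<le> 1" unfolding KN_zero_iff_form_rank_le_1[OF sym_A] .
  then show False using rank_two by simp
qed

lemma R_expand: "R x1 x2 x3 x4 = 1 / 2 * KN A A x1 x2 x3 x4 + \<rho> * KN h A x1 x2 x3 x4 + \<rho>\<^sup>2 / 2 * KN h h x1 x2 x3 x4"
  by (simp add: R_def KN_def S_eq field_simps power2_eq_square)

text \<open>The factor (n - 2) \<tau> turns the coefficient \<rho> of h \<and> A into d \<tau>,
  exactly the multiple of A that \<open>sq2_D\<close> expresses through D and D^2; the A \<and> A
  term is handled by \<open>KN_D\<close>.\<close>

lemma R_formula:
  assumes "x1 \<in> V" "x2 \<in> V" "x3 \<in> V" "x4 \<in> V"
  shows "(n - 2) * \<tau> * R x1 x2 x3 x4 = (n - 2) / 2 * KN D D x1 x2 x3 x4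
    + (n - 2) * \<tau> * \<rho>\<^sup>2 / 2 * KN h h x1 x2 x3 x4
    + (\<tau> - scal V h R + n * \<alpha>) * KN h D x1 x2 x3 x4 + KN h (sq2 V h D) x1 x2 x3 x4"
proof -
  have k: "\<tau> - scal V h R + n * \<alpha> = d\<^sup>2 - s"
    unfolding scal_R tr_D \<tau>_eq c_def by algebra
  have D2: "sq2 V h D x y = d * \<tau> * A x y - (d\<^sup>2 - s) * D x y" if "x \<in> V" "y \<in> V" for x y
    using sq2_D[OF that] by linarith
  have "KN h (sq2 V h D) x1 x2 x3 x4 = d * \<tau> * KN h A x1 x2 x3 x4 - (d\<^sup>2 - s) * KN h D x1 x2 x3 x4"
    by (simp only: KN_def D2 assms) (simp add: algebra_simps)
  moreover have "(n - 2) * \<tau> * R x1 x2 x3 x4 =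
      (n - 2) / 2 * (\<tau> * KN A A x1 x2 x3 x4) + d * \<tau> * KN h A x1 x2 x3 x4
      + (n - 2) * \<tau> * \<rho>\<^sup>2 / 2 * KN h h x1 x2 x3 x4"
    unfolding R_expand d_def by (simp add: algebra_simps)
  ultimately show ?thesis
    unfolding k KN_D[OF assms] by linarith
qed

end

section \<open>Derivation actions on combinations of Kulkarni-Nomizu products\<close>

definition act2 :: "('v \<Rightarrow> 'v \<Rightarrow> 'v \<Rightarrow> 'v) \<Rightarrow> 'v tensor2 \<Rightarrow> 'v \<Rightarrow> 'v \<Rightarrow> 'v tensor2" where
  "act2 L E x y z1 z2 = - (E (L x y z1) z2 + E z1 (L x y z2))"

context scalar_product_space
begin

text \<open>The common shape of R and its Weyl tensor once D^2 is a multiple of D; the commutator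
  identity then becomes a comparison of coefficients.\<close>

definition KN_comb :: "'n affine_space tensor4 \<Rightarrow> 'n affine_space tensor2 \<Rightarrow> real \<Rightarrow> real \<Rightarrow> real \<Rightarrow> bool" where
  "KN_comb T D p q r \<longleftrightarrow> (\<forall>x1\<in>V. \<forall>x2\<in>V. \<forall>x3\<in>V. \<forall>x4\<in>V.
     T x1 x2 x3 x4 = p * KN D D x1 x2 x3 x4 + q * KN h D x1 x2 x3 x4 + r * KN h h x1 x2 x3 x4)"

text \<open>Leibniz rule: the action is a derivation and the Kulkarni-Nomizu product is symmetric,
  whence the factors 2.\<close>

lemma endo_act_KN_comb:
  assumes T: "KN_comb T D p q r" and L: "\<And>z. z \<in> V \<Longrightarrow> L x y z \<in> V"
    and x: "x1 \<in> V" "x2 \<in> V" "x3 \<in> V" "x4 \<in> V"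
  shows "endo_act L T x1 x2 x3 x4 x y =
    2 * p * KN D (act2 L D x y) x1 x2 x3 x4
    + q * (KN D (act2 L h x y) x1 x2 x3 x4 + KN h (act2 L D x y) x1 x2 x3 x4)
    + 2 * r * KN h (act2 L h x y) x1 x2 x3 x4"
proof -
  have T': "T x1 x2 x3 x4 = p * KN D D x1 x2 x3 x4 + q * KN h D x1 x2 x3 x4 + r * KN h h x1 x2 x3 x4"
    if "x1 \<in> V" "x2 \<in> V" "x3 \<in> V" "x4 \<in> V" for x1 x2 x3 x4
    using T that unfolding KN_comb_def by blast
  show ?thesis
    unfolding endo_act_def by (simp only: T' L x) (simp add: KN_def act2_def algebra_simps)
qed

lemma curv_op:
  assumes "linear_form_on V (T x y z)"
  shows "curv_op V h T x y z \<in> V" "w \<in> V \<Longrightarrow> h (curv_op V h T x y z) w = T x y z w"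
  using theI'[OF riesz[OF assms]] unfolding curv_op_def by auto

lemma linear_form_KN_comb:
  assumes T: "KN_comb T D p q r" and D: "sym_form_on V D" and x: "x1 \<in> V" "x2 \<in> V" "x3 \<in> V"
  shows "linear_form_on V (T x1 x2 x3)"
proof -
  have "linear_form_on V (\<lambda>x4. p * KN D D x1 x2 x3 x4 + q * KN h D x1 x2 x3 x4 + r * KN h h x1 x2 x3 x4)"
    unfolding KN_def using x D sym_h
    by (intro linear_form_on_add linear_form_on_diff linear_form_on_cmult linear_form_on_multc
        sym_form_on_right)
  then show ?thesis
    using T x unfolding KN_comb_def linear_form_on_def by simp
qed

lemma form_curv_op:
  assumes T: "linear_form_on V (T x y z1)" and E: "sym_form_on V E" and z2: "z2 \<in> V"
  shows "E (curv_op V h T x y z1) z2 = T x y z1 (endo_of V h E z2)"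
    "E z2 (curv_op V h T x y z1) = T x y z1 (endo_of V h E z2)"
proof -
  note L = curv_op[of T, OF T]
  note z2' = endo_of[OF E z2]
  show *: "E z2 (curv_op V h T x y z1) = T x y z1 (endo_of V h E z2)"
    using z2'(2)[OF L(1)] L(2)[OF z2'(1)] sym_form_on_commute[OF sym_h L(1) z2'(1)] by simp
  show "E (curv_op V h T x y z1) z2 = T x y z1 (endo_of V h E z2)"
    using * sym_form_on_commute[OF E L(1) z2] by simp
qed

text \<open>T annihilates h by antisymmetry in its last two arguments. In the action on D, moving D
  into the last slot of T makes the D \<and> D part antisymmetric in z1, z2 because D^2 = l D, so it
  cancels; h \<and> D contributes l Q(h,D) and h \<and> h contributes 2 Q(h,D).\<close>

lemma act2_curv_op:
  assumes T: "KN_comb T D p q r" and D: "sym_form_on V D"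
    and D2: "\<And>x y. x \<in> V \<Longrightarrow> y \<in> V \<Longrightarrow> sq2 V h D x y = l * D x y"
    and x: "x \<in> V" "y \<in> V" "z1 \<in> V" "z2 \<in> V"
  shows "act2 (curv_op V h T) h x y z1 z2 = 0"
    "act2 (curv_op V h T) D x y z1 z2 = (l * q + 2 * r) * act2 (wedge_op h) D x y z1 z2"
proof -
  note lin = linear_form_KN_comb[OF T D x(1,2)]
  have T': "T x1 x2 x3 x4 = p * KN D D x1 x2 x3 x4 + q * KN h D x1 x2 x3 x4 + r * KN h h x1 x2 x3 x4"
    if "x1 \<in> V" "x2 \<in> V" "x3 \<in> V" "x4 \<in> V" for x1 x2 x3 x4
    using T that unfolding KN_comb_def by blast
  have "act2 (curv_op V h T) h x y z1 z2 = - (T x y z1 z2 + T x y z2 z1)"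
    unfolding act2_def using curv_op(2)[of T, OF lin] curv_op(1)[of T, OF lin] x sym_form_on_commute[OF sym_h, of z1]
    by simp
  then show "act2 (curv_op V h T) h x y z1 z2 = 0"
    by (simp only: T' x) (simp add: KN_def algebra_simps)
  have endo: "endo_of V h D z1 \<in> V" "endo_of V h D z2 \<in> V" using endo_of(1)[OF D] x by auto
  have hD: "h v (endo_of V h D z) = D v z" "D v (endo_of V h D z) = l * D v z" if "v \<in> V" "z \<in> V" for v z
  proof -
    have z': "endo_of V h D z \<in> V" by (rule endo_of(1)[OF D that(2)])
    show "h v (endo_of V h D z) = D v z"
      using endo_of(2)[OF D that(2,1)] sym_form_on_commute[OF sym_h that(1) z']
        sym_form_on_commute[OF D that] by simp
    show "D v (endo_of V h D z) = l * D v z"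
      using D2[OF that(2,1)] sym_form_on_commute[OF D that(1) z'] sym_form_on_commute[OF D that]
      by (simp add: sq2_def)
  qed
  have "act2 (curv_op V h T) D x y z1 z2 = - (T x y z1 (endo_of V h D z2) + T x y z2 (endo_of V h D z1))"
    unfolding act2_def form_curv_op[of T, OF lin[OF x(3)] D x(4)] form_curv_op[of T, OF lin[OF x(4)] D x(3)] ..
  also have "\<dots> = (l * q + 2 * r) * - (h y z1 * D x z2 - h x z1 * D y z2 + (h y z2 * D x z1 - h x z2 * D y z1))"
    by (simp only: T' x endo KN_def hD) (simp add: algebra_simps)
  also have "\<dots> = (l * q + 2 * r) * act2 (wedge_op h) D x y z1 z2"
    unfolding act2_def wedge_op_def using x
    by (simp add: form_simps(3,4,5,6)[OF D] sym_form_on_commute[OF D, of z1])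
  finally show "act2 (curv_op V h T) D x y z1 z2 = (l * q + 2 * r) * act2 (wedge_op h) D x y z1 z2" .
qed

text \<open>Rests on Q(h,h) = 0, Q(D,D) = 0 and Q(D,h) = -Q(h,D), together with linearity of Q in
  its first argument.\<close>

lemma act2_wedge_op:
  assumes D: "sym_form_on V D" and E: "\<And>x y. x \<in> V \<Longrightarrow> y \<in> V \<Longrightarrow> E x y = D x y + a * h x y"
    and x: "x \<in> V" "y \<in> V" "z1 \<in> V" "z2 \<in> V"
  shows "act2 (wedge_op h) h x y z1 z2 = 0"
    "act2 (wedge_op E) h x y z1 z2 = - act2 (wedge_op h) D x y z1 z2"
    "act2 (wedge_op E) D x y z1 z2 = a * act2 (wedge_op h) D x y z1 z2"
  unfolding act2_def wedge_op_def
  using x sym_form_on_commute[OF D, of z1] sym_form_on_commute[OF sym_h, of z1]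
  by (simp_all add: E form_simps(3,4,5,6)[OF D] form_simps(3,4,5,6)[OF sym_h])
    (auto simp: algebra_simps)

lemma KN_cong:
  assumes "\<And>x y. x \<in> V \<Longrightarrow> y \<in> V \<Longrightarrow> E x y = E' x y" "\<And>x y. x \<in> V \<Longrightarrow> y \<in> V \<Longrightarrow> F x y = F' x y"
    "x1 \<in> V" "x2 \<in> V" "x3 \<in> V" "x4 \<in> V"
  shows "KN E F x1 x2 x3 x4 = KN E' F' x1 x2 x3 x4"
  using assms by (simp add: KN_def)

lemma KN_cmult_right: "KN E (\<lambda>x y. k * F x y) x1 x2 x3 x4 = k * KN E F x1 x2 x3 x4"
  by (simp add: KN_def algebra_simps)

lemma curv_dot_KN_comb:
  assumes T: "KN_comb T D p q r" and U: "KN_comb U D p' q' r'" and D: "sym_form_on V D"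
    and D2: "\<And>x y. x \<in> V \<Longrightarrow> y \<in> V \<Longrightarrow> sq2 V h D x y = l * D x y"
    and x: "x1 \<in> V" "x2 \<in> V" "x3 \<in> V" "x4 \<in> V" "x \<in> V" "y \<in> V"
  defines "Q \<equiv> act2 (wedge_op h) D x y"
  shows "curv_dot V h T U x1 x2 x3 x4 x y =
    (l * q + 2 * r) * (2 * p' * KN D Q x1 x2 x3 x4 + q' * KN h Q x1 x2 x3 x4)"
proof -
  let ?L = "curv_op V h T"
  have L: "?L x y z \<in> V" if "z \<in> V" for z
    using curv_op(1)[of T, OF linear_form_KN_comb[OF T D x(5,6) that]] .
  note act = act2_curv_op[OF T D D2 x(5,6)]
  have 0: "KN E (act2 ?L h x y) x1 x2 x3 x4 = 0" for E
    using KN_cong[of E E "act2 ?L h x y" "\<lambda>_ _. 0", OF refl act(1) x(1-4)] by (simp add: KN_def)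
  have 1: "KN E (act2 ?L D x y) x1 x2 x3 x4 = (l * q + 2 * r) * KN E Q x1 x2 x3 x4" for E
    using KN_cong[of E E "act2 ?L D x y" "\<lambda>u v. (l * q + 2 * r) * Q u v", OF refl act(2)[folded Q_def] x(1-4)]
    by (simp only: KN_cmult_right)
  show ?thesis
    unfolding curv_dot_def
    by (subst endo_act_KN_comb[OF U _ x(1-4)], erule L) (simp add: 0 1 algebra_simps)
qed

lemma Tachibana_KN_comb:
  assumes U: "KN_comb U D p q r" and D: "sym_form_on V D" and E: "\<And>x y. x \<in> V \<Longrightarrow> y \<in> V \<Longrightarrow> E x y = D x y + a * h x y"
    and x: "x1 \<in> V" "x2 \<in> V" "x3 \<in> V" "x4 \<in> V" "x \<in> V" "y \<in> V"
  defines "Q \<equiv> act2 (wedge_op h) D x y"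
  shows "Tachibana h U x1 x2 x3 x4 x y = 2 * p * KN D Q x1 x2 x3 x4 + q * KN h Q x1 x2 x3 x4"
    "Tachibana E U x1 x2 x3 x4 x y =
      2 * p * a * KN D Q x1 x2 x3 x4 + q * (a * KN h Q x1 x2 x3 x4 - KN D Q x1 x2 x3 x4) - 2 * r * KN h Q x1 x2 x3 x4"
proof -
  have L: "wedge_op G x y z \<in> V" for z G
    using x by (simp add: wedge_op_def)
  note act = act2_wedge_op[OF D E x(5,6)]
  have 0: "KN G (act2 (wedge_op h) h x y) x1 x2 x3 x4 = 0" for G
    using KN_cong[of G G "act2 (wedge_op h) h x y" "\<lambda>_ _. 0", OF refl act(1) x(1-4)] by (simp add: KN_def)
  have 1: "KN G (act2 (wedge_op E) h x y) x1 x2 x3 x4 = -1 * KN G Q x1 x2 x3 x4" for G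
    using KN_cong[of G G "act2 (wedge_op E) h x y" "\<lambda>u v. -1 * Q u v", OF refl _ x(1-4)] act(2)
    unfolding KN_cmult_right Q_def by simp
  have 2: "KN G (act2 (wedge_op E) D x y) x1 x2 x3 x4 = a * KN G Q x1 x2 x3 x4" for G
    using KN_cong[of G G "act2 (wedge_op E) D x y" "\<lambda>u v. a * Q u v", OF refl _ x(1-4)] act(3)
    unfolding KN_cmult_right Q_def by simp
  show "Tachibana h U x1 x2 x3 x4 x y = 2 * p * KN D Q x1 x2 x3 x4 + q * KN h Q x1 x2 x3 x4"
    unfolding Tachibana_def endo_act_KN_comb[where L = "wedge_op h" and x = x and y = y, OF U L x(1-4)] 0 by (simp add: Q_def)
  show "Tachibana E U x1 x2 x3 x4 x y =
      2 * p * a * KN D Q x1 x2 x3 x4 + q * (a * KN h Q x1 x2 x3 x4 - KN D Q x1 x2 x3 x4) - 2 * r * KN h Q x1 x2 x3 x4"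
    unfolding Tachibana_def endo_act_KN_comb[where L = "wedge_op E" and x = x and y = y, OF U L x(1-4)] 1 2 by (simp add: algebra_simps)
qed

end

section \<open>The identities for B, for its Weyl tensor, and for the commutator\<close>

context quasi_umbilical_form
begin

lemma \<kappa>_t2: "(scal V h B)\<^sup>2 - tr2 V h (sq2 V h (Ric V h B)) = 2 * s * \<tau>"
  unfolding scal_B tr2_sq2_Ric_B tr_sq2_D by simp

text \<open>\<open>R_formula\<close> divided by (n - 2) \<tau>. The coefficients of h \<and> h agree
  because (\<kappa>^2 - tr(Ric(B)^2)) \<phi> - \<kappa> = 2 s - (d t + 2 s) = -d t, while \<rho>^2/2
  - \<alpha>/(2 (n - 1)) is -d t over 2 (n - 2) (n - 1).\<close>

lemma B_formula:
  assumes "\<tau> \<noteq> 0" and x: "x1 \<in> V" "x2 \<in> V" "x3 \<in> V" "x4 \<in> V"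
  defines "\<phi> \<equiv> 1 / \<tau>" and "\<kappa> \<equiv> scal V h B"
  shows "B x1 x2 x3 x4 = \<phi> / 2 * KN (Ric V h B) (Ric V h B) x1 x2 x3 x4
    + \<phi> / (n - 2) * KN h (sq2 V h (Ric V h B)) x1 x2 x3 x4
    + (1 - \<kappa> * \<phi>) / (n - 2) * KN h (Ric V h B) x1 x2 x3 x4
    + ((\<kappa>\<^sup>2 - tr2 V h (sq2 V h (Ric V h B))) * \<phi> - \<kappa>) / (2 * (n - 2) * (n - 1)) * KN h h x1 x2 x3 x4"
proof -
  have n: "n - 2 \<noteq> 0" "n - 1 \<noteq> 0" using n_ge by auto
  have "\<tau> - scal V h R + n * \<alpha> = \<tau> - \<kappa>"
    by (simp add: scal_R scal_B \<kappa>_def)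
  then have "(n - 2) * \<tau> * R x1 x2 x3 x4 = (n - 2) / 2 * KN D D x1 x2 x3 x4
    + (n - 2) * \<tau> * \<rho>\<^sup>2 / 2 * KN h h x1 x2 x3 x4
    + (\<tau> - \<kappa>) * KN h D x1 x2 x3 x4 + KN h (sq2 V h D) x1 x2 x3 x4"
    using R_formula[OF x] by simp
  then have R: "R x1 x2 x3 x4 = \<phi> / 2 * KN D D x1 x2 x3 x4 + \<rho>\<^sup>2 / 2 * KN h h x1 x2 x3 x4
    + (1 - \<kappa> * \<phi>) / (n - 2) * KN h D x1 x2 x3 x4 + \<phi> / (n - 2) * KN h (sq2 V h D) x1 x2 x3 x4"
  proof -
    \<comment> \<open>The tensor values are replaced by real variables, so that the division is pure
      field arithmetic.\<close>
    have "r = 1 / \<tau> / 2 * a + w / 2 * g + (1 - \<kappa> * (1 / \<tau>)) / m * e + 1 / \<tau> / m * b"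
      if "m * \<tau> * r = m / 2 * a + m * \<tau> * w / 2 * g + (\<tau> - \<kappa>) * e + b" "m \<noteq> 0" for m r a w g e b
    proof -
      have "r = (m / 2 * a + m * \<tau> * w / 2 * g + (\<tau> - \<kappa>) * e + b) / (m * \<tau>)"
        using that assms(1) by (simp add: eq_divide_eq mult.commute)
      then show ?thesis
        using that(2) assms(1) by (simp add: add_divide_distrib diff_divide_distrib algebra_simps)
    qed
    then show ?thesis
      unfolding \<phi>_def using \<open>(n - 2) * \<tau> * R x1 x2 x3 x4 = _\<close> n(1) by blast
  qed
  have "(\<kappa>\<^sup>2 - tr2 V h (sq2 V h (Ric V h B))) * \<phi> - \<kappa> = - d * t"
    unfolding \<kappa>_def \<kappa>_t2 using assms(1) by (simp add: \<phi>_def scal_B tr_D)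
  moreover have "\<rho>\<^sup>2 / 2 - \<alpha> / (2 * (n - 1)) = - d * t / (2 * (n - 2) * (n - 1))"
  proof -
    have "\<alpha> = \<rho> * t + (n - 1) * \<rho>\<^sup>2"
      by (simp add: \<alpha>_def tr2_A algebra_simps power2_eq_square)
    moreover have "x / (2 * k) = a / (2 * k) + b / 2" if "x = a + k * b" "k \<noteq> 0" for x a b k :: real
      using that by (simp add: field_simps)
    ultimately have "\<alpha> / (2 * (n - 1)) = \<rho> * t / (2 * (n - 1)) + \<rho>\<^sup>2 / 2"
      using n(2) by blast
    moreover have "- d * t / (2 * (n - 2) * (n - 1)) = - (\<rho> * t / (2 * (n - 1)))"
    proof -
      have "- (m * \<rho>) * t / (2 * m * k) = - (\<rho> * t / (2 * k))" if "m \<noteq> 0" for m k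
        using that by simp
      then show ?thesis unfolding d_def using n(1) by blast
    qed
    ultimately show ?thesis by simp
  qed
  ultimately have k: "((\<kappa>\<^sup>2 - tr2 V h (sq2 V h (Ric V h B))) * \<phi> - \<kappa>) / (2 * (n - 2) * (n - 1)) * KN h h x1 x2 x3 x4
      = \<rho>\<^sup>2 / 2 * KN h h x1 x2 x3 x4 - \<alpha> / (2 * (n - 1)) * KN h h x1 x2 x3 x4"
    by (simp only: left_diff_distrib[symmetric])
  have KN_B: "KN (Ric V h B) (Ric V h B) x1 x2 x3 x4 = KN D D x1 x2 x3 x4"
    "KN h (Ric V h B) x1 x2 x3 x4 = KN h D x1 x2 x3 x4"
    "KN h (sq2 V h (Ric V h B)) x1 x2 x3 x4 = KN h (sq2 V h D) x1 x2 x3 x4"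
    using KN_cong[OF Ric_B Ric_B x] KN_cong[OF refl Ric_B x] KN_cong[OF refl sq2_Ric_B x] by simp_all
  show ?thesis
    unfolding k KN_B using R by (simp add: B_def)
qed

text \<open>Passing from B to Weyl(B) removes precisely the two terms of \<open>B_formula\<close>
  that do not carry the factor \<phi>.\<close>

lemma Weyl_B_formula:
  assumes "\<tau> \<noteq> 0" and x: "x1 \<in> V" "x2 \<in> V" "x3 \<in> V" "x4 \<in> V"
  defines "\<phi> \<equiv> 1 / \<tau>" and "\<kappa> \<equiv> scal V h B"
  shows "Weyl V h B x1 x2 x3 x4 = \<phi> * (1 / 2 * KN (Ric V h B) (Ric V h B) x1 x2 x3 x4
    + 1 / (n - 2) * KN h (sq2 V h (Ric V h B)) x1 x2 x3 x4
    - \<kappa> / (n - 2) * KN h (Ric V h B) x1 x2 x3 x4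
    + (\<kappa>\<^sup>2 - tr2 V h (sq2 V h (Ric V h B))) / (2 * (n - 2) * (n - 1)) * KN h h x1 x2 x3 x4)"
proof -
  have "f / 2 * a + f / v * b + (1 - k * f) / v * e + (K * f - k) / m * g - 1 / v * e + k / m * g
      = f * (1 / 2 * a + 1 / v * b - k / v * e + K / m * g)" for f a b e g k K v m :: real
    by (simp add: diff_divide_distrib algebra_simps)
  then show ?thesis
    unfolding Weyl_def Let_def n_def[symmetric] B_formula[OF assms(1) x] \<phi>_def \<kappa>_def .
qed

lemma two_term_D: "two_term D"
  by (rule two_term_endo[OF sym_A two_term_A, of _ c "-1"]) (simp add: D_eq sq2_def)

lemma Ric_R_eq: "Ric V h R x y = D x y + \<alpha> * h x y"
  by (simp add: D_def sub_smult_def)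

lemma sq2_Ric_R:
  assumes "x \<in> V" "y \<in> V"
  shows "sq2 V h (Ric V h R) x y = sq2 V h D x y + 2 * \<alpha> * D x y + \<alpha>\<^sup>2 * h x y"
proof -
  note L = endo_of[OF sym_D assms(1)]
  have "endo_of V h (Ric V h R) x = endo_of V h D x + \<alpha> *\<^sub>R x"
    using assms(1) L by (intro endo_of_unique[OF sym_Ric_R])
      (simp_all add: form_simps(1,5)[OF sym_h] Ric_R_eq)
  then have "sq2 V h (Ric V h R) x y = D (endo_of V h D x + \<alpha> *\<^sub>R x) y + \<alpha> * h (endo_of V h D x + \<alpha> *\<^sub>R x) y"
    by (simp add: sq2_def Ric_R_eq)
  also have "\<dots> = sq2 V h D x y + 2 * \<alpha> * D x y + \<alpha>\<^sup>2 * h x y"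
    using assms L by (simp add: form_simps(1,5)[OF sym_h] form_simps(1,5)[OF sym_D] sq2_def
        power2_eq_square algebra_simps)
  finally show ?thesis .
qed

text \<open>Inserting Ric(R) = D + \<alpha> h into the quadratic relation gives D^2 = l D + \<mu> h,
  which is where l comes from.\<close>

lemma sq2_D_proportional:
  assumes \<tau>: "\<tau> \<noteq> 0"
    and Ric2: "\<And>x y. x \<in> V \<Longrightarrow> y \<in> V \<Longrightarrow> sq2 V h (Ric V h R) x y = \<rho>1 * Ric V h R x y + \<rho>2 * h x y"
  defines "l \<equiv> \<rho>1 - 2 * \<alpha>"
  shows "x \<in> V \<Longrightarrow> y \<in> V \<Longrightarrow> sq2 V h D x y = l * D x y" and "tr D = 2 * l"
proof -
  define \<mu> where "\<mu> = \<rho>1 * \<alpha> + \<rho>2 - \<alpha>\<^sup>2"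
  have D2: "sq2 V h D x y - l * D x y = \<mu> * h x y" if "x \<in> V" "y \<in> V" for x y
    using Ric2[OF that] unfolding sq2_Ric_R[OF that] Ric_R_eq l_def \<mu>_def by algebra
  \<comment> \<open>The left-hand side has rank at most 2 and \<open>h\<close> has rank at least 3.\<close>
  have "two_term (\<lambda>x y. sq2 V h D x y - l * D x y)"
    by (rule two_term_endo[OF sym_D two_term_D, of _ "- l" 1]) (simp add: sq2_def)
  from two_term_multiple_of_h[OF this D2] have "\<mu> = 0" using four_le by simp
  then have D2': "sq2 V h D x y = l * D x y" if "x \<in> V" "y \<in> V" for x y
    using D2[OF that] by simp
  then show "x \<in> V \<Longrightarrow> y \<in> V \<Longrightarrow> sq2 V h D x y = l * D x y" .
  \<comment> \<open>D satisfies D \<and> D^2 = (tr D / 2) D \<and> D just as A does. Since \<tau>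
    \<noteq> 0 makes D \<and> D nonzero, comparison with D^2 = l D yields the trace.\<close>
  have "\<not> form_rank V D \<le> 1" using rank_D_ge_2[OF \<tau>] by simp
  then obtain x1 x2 x3 x4 where x: "x1 \<in> V" "x2 \<in> V" "x3 \<in> V" "x4 \<in> V" and ne: "KN D D x1 x2 x3 x4 \<noteq> 0"
    unfolding KN_zero_iff_form_rank_le_1[OF sym_D] by blast
  have "KN D (sq2 V h D) x1 x2 x3 x4 = l * KN D D x1 x2 x3 x4"
    using KN_cong[of D D "sq2 V h D" "\<lambda>u v. l * D u v", OF refl D2' x] by (simp only: KN_cmult_right)
  with KN_sq2[OF sym_D two_term_D x] ne show "tr D = 2 * l" by simp
qed

text \<open>R and B differ by a multiple of h \<and> h, whose Weyl tensor is zero.\<close>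

lemma Weyl_R_eq:
  assumes "x1 \<in> V" "x2 \<in> V" "x3 \<in> V" "x4 \<in> V"
  shows "Weyl V h R x1 x2 x3 x4 = Weyl V h B x1 x2 x3 x4"
proof -
  have n: "n - 2 \<noteq> 0" "n - 1 \<noteq> 0" using n_ge by auto
  have 1: "KN h (Ric V h B) x1 x2 x3 x4 = KN h D x1 x2 x3 x4"
    by (rule KN_cong[OF refl Ric_B assms])
  have 2: "KN h (Ric V h R) x1 x2 x3 x4 = KN h D x1 x2 x3 x4 + \<alpha> * KN h h x1 x2 x3 x4"
    by (simp add: KN_def Ric_R_eq algebra_simps)
  have "\<alpha> / (2 * (n - 1)) = \<alpha> / (n - 2) - n * \<alpha> / (2 * (n - 2) * (n - 1))"
  proof -
    have "a / (2 * k) = m * a / (2 * m * k)" "a / m = 2 * k * a / (2 * m * k)"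
      if "m \<noteq> 0" "k \<noteq> 0" for a m k :: real
      using that by simp_all
    from this[OF n] have 3: "\<alpha> / (2 * (n - 1)) = (n - 2) * \<alpha> / (2 * (n - 2) * (n - 1))"
      "\<alpha> / (n - 2) = 2 * (n - 1) * \<alpha> / (2 * (n - 2) * (n - 1))"
      by blast+
    show ?thesis
      unfolding 3 diff_divide_distrib[symmetric] by (rule arg_cong2[where f = "(/)"], algebra, rule refl)
  qed
  moreover have "r - 1 / m * (e + a * g) + (T + N * a) / (2 * m * k) * g =
      r - a / (2 * k) * g - 1 / m * e + T / (2 * m * k) * g"
    if "a / (2 * k) = a / m - N * a / (2 * m * k)" for r m e a g T N k :: real
    unfolding that by (simp add: add_divide_distrib algebra_simps)
  ultimately show ?thesis
    unfolding Weyl_def Let_def n_def[symmetric] 1 2 scal_R scal_B unfolding B_def by blast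
qed

text \<open>With W and R both in the form \<open>KN_comb\<close>, each side is a combination of D
  \<and> Q(h,D) and h \<and> Q(h,D); the facts \<open>1\<close> and \<open>2\<close> below equate
  the respective coefficients.\<close>

lemma Weyl_R_commutator:
  assumes \<tau>: "\<tau> \<noteq> 0"
    and Ric2: "\<And>x y. x \<in> V \<Longrightarrow> y \<in> V \<Longrightarrow> sq2 V h (Ric V h R) x y = \<rho>1 * Ric V h R x y + \<rho>2 * h x y"
    and x: "x1 \<in> V" "x2 \<in> V" "x3 \<in> V" "x4 \<in> V" "x \<in> V" "y \<in> V"
  defines "W \<equiv> Weyl V h R"
  shows "curv_dot V h W R x1 x2 x3 x4 x y - curv_dot V h R W x1 x2 x3 x4 x y =
    Tachibana (Ric V h R) W x1 x2 x3 x4 x y - scal V h R / (n - 1) * Tachibana h W x1 x2 x3 x4 x y"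
proof -
  define l where "l = \<rho>1 - 2 * \<alpha>"
  define \<phi> where "\<phi> = 1 / \<tau>"
  \<comment> \<open>The coefficients of Weyl(B) for D^2 = l D, \<kappa>(B) = 2 l and tr(D^2) = 2
    l^2: the h \<and> D terms combine to l - 2 l, the h \<and> h terms to 4 l^2 - 2 l^2.\<close>
  define p where "p = \<phi> / 2"
  define q where "q = - \<phi> * l / (n - 2)"
  define r where "r = \<phi> * l\<^sup>2 / ((n - 2) * (n - 1))"
  \<comment> \<open>The definition of Weyl solved for R: adding the Ricci and scalar terms back,
    with Ric(R) = D + \<alpha> h, changes only the last two coefficients.\<close>
  define q' where "q' = q + 1 / (n - 2)"
  define r' where "r' = r + \<alpha> / (n - 2) - scal V h R / (2 * (n - 2) * (n - 1))"
  have n: "n - 2 \<noteq> 0" "n - 1 \<noteq> 0" using n_ge by auto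
  have D2: "sq2 V h D x y = l * D x y" if "x \<in> V" "y \<in> V" for x y
    using sq2_D_proportional(1)[OF \<tau>, of \<rho>1 \<rho>2 x y] Ric2 that unfolding l_def by blast
  have trD: "tr D = 2 * l"
    using sq2_D_proportional(2)[OF \<tau>, of \<rho>1 \<rho>2] Ric2 unfolding l_def by blast
  have trD2: "tr (sq2 V h D) = 2 * l\<^sup>2"
  proof -
    have "tr (sq2 V h D) = tr (\<lambda>x y. l * D x y + 0 * h x y)"
      by (rule tr_cong) (simp add: D2)
    then show ?thesis unfolding tr_linear trD by (simp add: power2_eq_square)
  qed
  have comb: "f * (1 / 2 * a + 1 / v * (l * b) - 2 * l / v * b + ((2 * l)\<^sup>2 - 2 * l\<^sup>2) / (2 * v * m) * g)
      = f / 2 * a + - f * l / v * b + f * l\<^sup>2 / (v * m) * g" for f a b g v m :: real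
    by (simp add: algebra_simps)
  have W: "KN_comb W D p q r"
    unfolding KN_comb_def
  proof (intro ballI)
    fix x1 x2 x3 x4 assume x: "x1 \<in> V" "x2 \<in> V" "x3 \<in> V" "x4 \<in> V"
    have KN_B: "KN (Ric V h B) (Ric V h B) x1 x2 x3 x4 = KN D D x1 x2 x3 x4"
      "KN h (Ric V h B) x1 x2 x3 x4 = KN h D x1 x2 x3 x4"
      "KN h (sq2 V h (Ric V h B)) x1 x2 x3 x4 = l * KN h D x1 x2 x3 x4"
      using KN_cong[OF Ric_B Ric_B x] KN_cong[OF refl Ric_B x]
        KN_cong[of h h _ "\<lambda>u v. l * D u v", OF refl trans[OF sq2_Ric_B D2] x]
      unfolding KN_cmult_right by simp_all
    show "W x1 x2 x3 x4 = p * KN D D x1 x2 x3 x4 + q * KN h D x1 x2 x3 x4 + r * KN h h x1 x2 x3 x4"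
      unfolding W_def Weyl_R_eq[OF x] Weyl_B_formula[OF \<tau> x] KN_B tr2_sq2_Ric_B scal_B trD trD2
      unfolding p_def q_def r_def \<phi>_def[symmetric] by (rule comb)
  qed
  have R: "KN_comb R D p q' r'"
    unfolding KN_comb_def
  proof (intro ballI)
    fix x1 x2 x3 x4 assume x: "x1 \<in> V" "x2 \<in> V" "x3 \<in> V" "x4 \<in> V"
    have KN_R: "KN h (Ric V h R) x1 x2 x3 x4 = KN h D x1 x2 x3 x4 + \<alpha> * KN h h x1 x2 x3 x4"
      by (simp add: KN_def Ric_R_eq algebra_simps)
    have "W x1 x2 x3 x4 = R x1 x2 x3 x4 - 1 / (n - 2) * (KN h D x1 x2 x3 x4 + \<alpha> * KN h h x1 x2 x3 x4)
      + scal V h R / (2 * (n - 2) * (n - 1)) * KN h h x1 x2 x3 x4"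
      unfolding W_def Weyl_def Let_def n_def[symmetric] KN_R ..
    moreover have "W x1 x2 x3 x4 = p * KN D D x1 x2 x3 x4 + q * KN h D x1 x2 x3 x4 + r * KN h h x1 x2 x3 x4"
      using W x unfolding KN_comb_def by blast
    ultimately show "R x1 x2 x3 x4 = p * KN D D x1 x2 x3 x4 + q' * KN h D x1 x2 x3 x4 + r' * KN h h x1 x2 x3 x4"
      unfolding q'_def r'_def by (simp add: algebra_simps)
  qed
  have scal: "scal V h R = 2 * l + n * \<alpha>" by (simp add: scal_R trD)
  \<comment> \<open>With the reciprocals as variables, the relations n u = 1 + u and u v = v - u
    make the coefficient identities polynomial.\<close>
  define u where "u = 1 / (n - 1)"
  define v where "v = 1 / (n - 2)"
  have uv: "n * u = 1 + u" "u * v = v - u"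
    using n by (auto simp: u_def v_def field_simps)
  have unv: "u * n * v = v - u + v"
    using uv by algebra
  have coeffs: "q = - \<phi> * l * v" "r = \<phi> * l\<^sup>2 * (u * v)" "q' = q + v"
    "2 * r' = 2 * r + 2 * \<alpha> * v - 2 * l * (u * v) - \<alpha> * (u * n * v)"
    "scal V h R / (n - 1) = 2 * l * u + \<alpha> * (n * u)"
  proof -
    have "2 * (r + a / m - (2 * l + N * a) / (2 * m * k)) =
        2 * r + 2 * a * (1 / m) - 2 * l * (1 / k * (1 / m)) - a * (1 / k * N * (1 / m))"
      and "(2 * l + N * a) / k = 2 * l * (1 / k) + a * (N * (1 / k))" for r a m l N k :: real
      by (simp_all add: add_divide_distrib algebra_simps)
    then show "2 * r' = 2 * r + 2 * \<alpha> * v - 2 * l * (u * v) - \<alpha> * (u * n * v)"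
      "scal V h R / (n - 1) = 2 * l * u + \<alpha> * (n * u)"
      unfolding r'_def scal u_def v_def by blast+
  qed (simp_all add: q_def r_def q'_def u_def v_def)
  have 1: "(l * q + 2 * r) * (2 * p) - (l * q' + 2 * r') * (2 * p) =
      2 * p * \<alpha> - q - scal V h R / (n - 1) * (2 * p)"
    unfolding coeffs p_def uv unv by (simp add: algebra_simps)
  have 2: "(l * q + 2 * r) * q' - (l * q' + 2 * r') * q = q * \<alpha> - 2 * r - scal V h R / (n - 1) * q"
    unfolding coeffs using uv by algebra
  have combine: "a * (P * k + q' * K) - b * (P * k + q * K) = P * \<alpha> * k + q * (\<alpha> * K - k) - 2 * r * K - m * (P * k + q * K)"
    if "a * P - b * P = P * \<alpha> - q - m * P" "a * q' - b * q = q * \<alpha> - 2 * r - m * q" for a b P k K m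
  proof -
    have "a * (P * k + q' * K) - b * (P * k + q * K) = (a * P - b * P) * k + (a * q' - b * q) * K"
      by (simp add: algebra_simps)
    then show ?thesis unfolding that by (simp add: algebra_simps)
  qed
  have dot: "curv_dot V h T U x1 x2 x3 x4 x y = (l * b + 2 * c) * (2 * a' * KN D (act2 (wedge_op h) D x y) x1 x2 x3 x4
      + b' * KN h (act2 (wedge_op h) D x y) x1 x2 x3 x4)"
    if "KN_comb T D a b c" "KN_comb U D a' b' c'" for T U a b c a' b' c'
    by (rule curv_dot_KN_comb[OF that sym_D _ x]) (rule D2)
  show ?thesis
    unfolding dot[OF W R] dot[OF R W] Tachibana_KN_comb[OF W sym_D Ric_R_eq x]
    by (rule combine[OF 1 2])
qed

end

section \<open>Local parametrizations and the Gauss formula\<close>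

text \<open>
  Applied to a transition map \<open>T\<close> between two local parametrizations: it is differentiable because
  the derivative of an immersion has a left inverse.
\<close>

lemma has_derivative_implicit:
  fixes P :: "'a::real_normed_vector \<Rightarrow> 'b::real_normed_vector"
    and T :: "'c::real_normed_vector \<Rightarrow> 'a"
  assumes T: "isCont T v"
    and P: "(P has_derivative P') (at (T v))"
    and L: "bounded_linear L" "\<And>x. L (P' x) = x"
    and Q: "(Q has_derivative Q') (at v)"
    and eq: "\<forall>\<^sub>F w in nhds v. P (T w) = Q w"
  shows "(T has_derivative L \<circ> Q') (at v)"
proof -
  have LQ: "bounded_linear (L \<circ> Q')"
    using L(1) has_derivative_bounded_linear[OF Q] by (simp add: bounded_linear_compose comp_def)
  obtain K where K: "K > 0" "\<And>x. norm (L x) \<le> norm x * K"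
    using bounded_linear.pos_bounded[OF L(1)] by blast
  obtain C where C: "C > 0" "\<And>x. norm ((L \<circ> Q') x) \<le> norm x * C"
    using bounded_linear.pos_bounded[OF LQ] by blast
  have eqv: "P (T v) = Q v"
    using eq by (rule eventually_nhds_x_imp_x)
  have "\<exists>d>0. \<forall>w. norm (w - v) < d \<longrightarrow> norm (T w - T v - (L \<circ> Q') (w - v)) \<le> e * norm (w - v)"
    if "e > 0" for e
  proof -
    \<comment> \<open>The error of P is relative to the increment of T, which has no Lipschitz bound
      yet. The first entry makes K e' at most 1/2, so half of that increment is absorbed and it is
      at most 2 C + 1 times the increment of the argument; the second entry bounds the total error
      factor K e' (2 C + 2).\<close>
    define e' where "e' = min (1 / (2 * K)) (e / (K * (2 * C + 2)))"
    have e': "e' > 0" "K * e' \<le> 1 / 2" "K * e' * (2 * C + 2) \<le> e"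
    proof -
      show "e' > 0" using that K(1) C(1) by (simp add: e'_def)
      have *: "e' \<le> 1 / (2 * K)" "e' \<le> e / (K * (2 * C + 2))"
        by (simp_all add: e'_def)
      show "K * e' \<le> 1 / 2"
        using *(1) K(1) by (simp add: field_simps)
      have "K * (2 * C + 2) > 0"
        using K(1) C(1) by simp
      then show "K * e' * (2 * C + 2) \<le> e"
        using *(2) by (simp only: pos_le_divide_eq mult_ac)
    qed
    obtain d1 where d1: "d1 > 0"
      "\<And>y. norm (y - T v) < d1 \<Longrightarrow> norm (P y - P (T v) - P' (y - T v)) \<le> e' * norm (y - T v)"
      using P e'(1) unfolding has_derivative_at_alt by blast
    obtain d2 where d2: "d2 > 0"
      "\<And>y. norm (y - v) < d2 \<Longrightarrow> norm (Q y - Q v - Q' (y - v)) \<le> e' * norm (y - v)"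
      using Q e'(1) unfolding has_derivative_at_alt by blast
    obtain d3 where d3: "d3 > 0" "\<And>y. dist y v < d3 \<Longrightarrow> dist (T y) (T v) < d1"
      using T d1(1) unfolding continuous_at_eps_delta by (auto simp: dist_commute)
    obtain d4 where d4: "d4 > 0" "\<And>y. dist y v < d4 \<Longrightarrow> P (T y) = Q y"
      using eq unfolding eventually_nhds_metric by blast
    show ?thesis
    proof (intro exI[of _ "min d2 (min d3 d4)"] conjI allI impI)
      show "0 < min d2 (min d3 d4)" using d2 d3 d4 by simp
      fix w assume w: "norm (w - v) < min d2 (min d3 d4)"
      let ?p = "P (T w) - P (T v) - P' (T w - T v)" and ?q = "Q w - Q v - Q' (w - v)"
      have p: "norm ?p \<le> e' * norm (T w - T v)"
        using d1(2) d3(2)[of w] w by (simp add: dist_norm)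
      have q: "norm ?q \<le> e' * norm (w - v)"
        using d2(2) w by simp
      have PQ: "P (T w) - P (T v) = Q w - Q v"
        using d4(2)[of w] w eqv by (simp add: dist_norm)
      have "L ?q - L ?p = L (P' (T w - T v)) - L (Q' (w - v))"
        using PQ by (simp flip: linear_diff[OF bounded_linear.linear[OF L(1)]])
      then have id: "T w - T v - (L \<circ> Q') (w - v) = L ?q - L ?p"
        using L(2) by simp
      have Lq: "norm (L ?q) \<le> K * e' * norm (w - v)"
        using order.trans[OF K(2)[of ?q] mult_right_mono[OF q, of K]] K(1) by (simp add: mult_ac)
      have Lp: "norm (L ?p) \<le> K * e' * norm (T w - T v)"
        using order.trans[OF K(2)[of ?p] mult_right_mono[OF p, of K]] K(1) by (simp add: mult_ac)
      have *: "norm (T w - T v - (L \<circ> Q') (w - v)) \<le> K * e' * norm (w - v) + K * e' * norm (T w - T v)"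
        unfolding id using norm_triangle_ineq4[of "L ?q" "L ?p"] Lq Lp by linarith
      have "norm (T w - T v) \<le> norm ((L \<circ> Q') (w - v)) + norm (T w - T v - (L \<circ> Q') (w - v))"
        by (metis norm_triangle_sub)
      also have "\<dots> \<le> norm (w - v) * C + 1 / 2 * norm (w - v) + 1 / 2 * norm (T w - T v)"
        using C(2)[of "w - v"] * mult_right_mono[OF e'(2), of "norm (w - v)"]
          mult_right_mono[OF e'(2), of "norm (T w - T v)"] by simp
      finally have "norm (T w - T v) \<le> (2 * C + 1) * norm (w - v)"
        by (simp add: algebra_simps)
      then have "K * e' * norm (T w - T v) \<le> K * e' * ((2 * C + 1) * norm (w - v))"
        using K(1) e'(1) by (intro mult_left_mono) auto
      with * have "norm (T w - T v - (L \<circ> Q') (w - v)) \<le> K * e' * (2 * C + 2) * norm (w - v)"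
        by (simp add: algebra_simps)
      also have "\<dots> \<le> e * norm (w - v)"
        using e'(3) by (intro mult_right_mono) auto
      finally show "norm (T w - T v - (L \<circ> Q') (w - v)) \<le> e * norm (w - v)" .
    qed
  qed
  with LQ show ?thesis
    unfolding has_derivative_at_alt by blast
qed

section \<open>Smooth maps and the symmetry of second derivatives\<close>

lemma Ck_on_cong:
  assumes "open U" and "\<And>u. u \<in> U \<Longrightarrow> f u = g u"
  shows "Ck_on k U f \<longleftrightarrow> Ck_on k U g"
  using assms(2)
proof (induction k arbitrary: f g)
  case 0
  then show ?case by (simp cong: continuous_on_cong)
next
  case (Suc k)
  have deriv: "(f has_derivative f') (at u) \<longleftrightarrow> (g has_derivative f') (at u)" if "u \<in> U" for u f'
    using has_derivative_transform_within_open[OF _ \<open>open U\<close> that, of f f' UNIV g]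
      has_derivative_transform_within_open[OF _ \<open>open U\<close> that, of g f' UNIV f] Suc.prems by auto
  then have "f differentiable (at u) \<longleftrightarrow> g differentiable (at u)" if "u \<in> U" for u
    using that by (simp add: differentiable_def)
  moreover have "Ck_on k U (\<lambda>u. frechet_derivative f (at u) v) \<longleftrightarrow>
      Ck_on k U (\<lambda>u. frechet_derivative g (at u) v)" for v
    by (rule Suc.IH) (simp add: frechet_derivative_def deriv)
  ultimately show ?case by simp
qed

lemma smooth_on_cong:
  assumes "open U" and "\<And>u. u \<in> U \<Longrightarrow> f u = g u"
  shows "smooth_on U f \<longleftrightarrow> smooth_on U g"
  using Ck_on_cong[OF assms] by (simp add: smooth_on_def)

lemma smooth_on_has_derivative:
  assumes "smooth_on U f" "u \<in> U"
  shows "(f has_derivative frechet_derivative f (at u)) (at u)"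
  using assms Ck_on.simps(2)[of 0 U f] frechet_derivative_works
  unfolding smooth_on_def by blast

lemma smooth_on_frechet_derivative:
  assumes "smooth_on U f"
  shows "smooth_on U (\<lambda>u. frechet_derivative f (at u) v)"
  using assms Ck_on.simps(2)[of _ U f] unfolding smooth_on_def by blast

lemma smooth_on_imp_continuous_on: "smooth_on U f \<Longrightarrow> continuous_on U f"
  unfolding smooth_on_def using Ck_on.simps(1) by blast

text \<open>The mean value theorem applied twice, in direction a to the difference \<open>k\<close>
  and then in direction b to the derivative \<open>l\<close>. The left side is symmetric in a and b,
  which yields Schwarz's theorem.\<close>

lemma second_difference_mvt:
  fixes f :: "'a::real_normed_vector \<Rightarrow> real"
  assumes f: "\<And>v. v \<in> U \<Longrightarrow> (f has_derivative f' v) (at v)"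
    and g: "\<And>v. v \<in> U \<Longrightarrow> ((\<lambda>v. f' v a) has_derivative f'' v) (at v)"
    and U: "\<And>s r. 0 \<le> s \<Longrightarrow> s \<le> t \<Longrightarrow> 0 \<le> r \<Longrightarrow> r \<le> t \<Longrightarrow> u + s *\<^sub>R a + r *\<^sub>R b \<in> U"
    and t: "t > 0"
  obtains s r where "0 \<le> s" "s \<le> t" "0 \<le> r" "r \<le> t"
    "f (u + t *\<^sub>R a + t *\<^sub>R b) - f (u + t *\<^sub>R a) - f (u + t *\<^sub>R b) + f u = t^2 * f'' (u + s *\<^sub>R a + r *\<^sub>R b) b"
proof -
  define k where "k s = f (u + s *\<^sub>R a + t *\<^sub>R b) - f (u + s *\<^sub>R a)" for s
  have "(k has_real_derivative f' (u + s *\<^sub>R a + t *\<^sub>R b) a - f' (u + s *\<^sub>R a) a) (at s)"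
    if "0 \<le> s" "s \<le> t" for s
  proof -
    have 1: "((\<lambda>s. f (u + s *\<^sub>R a + t *\<^sub>R b)) has_derivative (\<lambda>x. f' (u + s *\<^sub>R a + t *\<^sub>R b) (x *\<^sub>R a))) (at s)"
      by (rule has_derivative_compose[of "\<lambda>s. u + s *\<^sub>R a + t *\<^sub>R b" "\<lambda>x. x *\<^sub>R a" s UNIV f])
        (auto intro!: derivative_eq_intros f U that less_imp_le[OF t])
    have 2: "((\<lambda>s. f (u + s *\<^sub>R a)) has_derivative (\<lambda>x. f' (u + s *\<^sub>R a) (x *\<^sub>R a))) (at s)"
      by (rule has_derivative_compose[of "\<lambda>s. u + s *\<^sub>R a" "\<lambda>x. x *\<^sub>R a" s UNIV f])
        (use U[OF that, of 0] t in \<open>auto intro!: derivative_eq_intros f\<close>)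
    have lin: "linear (f' (u + s *\<^sub>R a + t *\<^sub>R b))" "linear (f' (u + s *\<^sub>R a))"
      using f[OF U[OF that, of t]] f[OF U[OF that, of 0]] t
      by (auto simp: has_derivative_linear)
    have distrib: "x * y - x * z = (y - z) * x" for x y z :: real
      by (simp add: algebra_simps)
    show ?thesis
      unfolding has_field_derivative_def k_def
      by (rule has_derivative_eq_rhs[OF has_derivative_diff[OF 1 2]], rule ext)
        (simp only: linear_scale[OF lin(1)] linear_scale[OF lin(2)] real_scaleR_def distrib)
  qed
  from MVT2[OF t this] obtain s where s: "0 < s" "s < t"
    "k t - k 0 = (t - 0) * (f' (u + s *\<^sub>R a + t *\<^sub>R b) a - f' (u + s *\<^sub>R a) a)"
    by auto
  define l where "l r = f' (u + s *\<^sub>R a + r *\<^sub>R b) a" for r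
  have "(l has_real_derivative f'' (u + s *\<^sub>R a + r *\<^sub>R b) b) (at r)" if "0 \<le> r" "r \<le> t" for r
  proof -
    have in_U: "u + s *\<^sub>R a + r *\<^sub>R b \<in> U" using U s that by simp
    have 1: "((\<lambda>r. f' (u + s *\<^sub>R a + r *\<^sub>R b) a) has_derivative (\<lambda>x. f'' (u + s *\<^sub>R a + r *\<^sub>R b) (x *\<^sub>R b))) (at r)"
      by (rule has_derivative_compose[of "\<lambda>r. u + s *\<^sub>R a + r *\<^sub>R b" "\<lambda>x. x *\<^sub>R b" r UNIV "\<lambda>v. f' v a"])
        (auto intro!: derivative_eq_intros g in_U)
    show ?thesis
      unfolding has_field_derivative_def l_def
      by (rule has_derivative_eq_rhs[OF 1])
        (simp add: linear_scale[OF has_derivative_linear[OF g[OF in_U]]] fun_eq_iff mult.commute)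
  qed
  from MVT2[OF t this] obtain r where r: "0 < r" "r < t" "l t - l 0 = (t - 0) * f'' (u + s *\<^sub>R a + r *\<^sub>R b) b"
    by auto
  show ?thesis
  proof (rule that[of s r])
    have "k t - k 0 = t * (t * f'' (u + s *\<^sub>R a + r *\<^sub>R b) b)"
      using s(3) r(3) by (simp add: l_def)
    then show "f (u + t *\<^sub>R a + t *\<^sub>R b) - f (u + t *\<^sub>R a) - f (u + t *\<^sub>R b) + f u
        = t^2 * f'' (u + s *\<^sub>R a + r *\<^sub>R b) b"
      by (simp add: k_def power2_eq_square)
  qed (use s r in simp_all)
qed

text \<open>The same second difference equals both mixed derivatives, taken at two points near u;
  continuity compares each with its value at u.\<close>

lemma second_derivative_commute_real:
  fixes f :: "'a::real_normed_vector \<Rightarrow> real"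
  assumes U: "open U" "u \<in> U"
    and f: "\<And>v. v \<in> U \<Longrightarrow> (f has_derivative f' v) (at v)"
    and f'': "\<And>v c. v \<in> U \<Longrightarrow> ((\<lambda>v. f' v c) has_derivative f'' c v) (at v)"
    and cont: "\<And>c d. continuous_on U (\<lambda>v. f'' c v d)"
  shows "f'' a u b = f'' b u a"
proof -
  have near: "\<bar>f'' a u b - f'' b u a\<bar> < e" if "e > 0" for e
  proof -
    have lim: "((\<lambda>v. f'' c v d) \<longlongrightarrow> f'' c u d) (nhds u)" for c d
      using cont[of c d] U tendsto_at_iff_tendsto_nhds[of "\<lambda>v. f'' c v d" u]
      by (simp add: continuous_on_eq_continuous_at isCont_def)
    have "\<forall>\<^sub>F v in nhds u. \<bar>f'' a v b - f'' a u b\<bar> < e / 2 \<and> \<bar>f'' b v a - f'' b u a\<bar> < e / 2 \<and> v \<in> U"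
      using tendstoD[OF lim[of a b] half_gt_zero[OF that]] tendstoD[OF lim[of b a] half_gt_zero[OF that]]
        eventually_nhds_in_open[OF U]
      unfolding dist_real_def by (intro eventually_conj)
    then obtain d where d: "d > 0" "\<And>v. dist v u < d \<Longrightarrow>
        \<bar>f'' a v b - f'' a u b\<bar> < e / 2 \<and> \<bar>f'' b v a - f'' b u a\<bar> < e / 2 \<and> v \<in> U"
      unfolding eventually_nhds_metric by blast
    \<comment> \<open>Keeps the parallelogram spanned by t a and t b inside the ball of radius d;
      the summand 1 makes the denominator positive and the estimate strict.\<close>
    define t where "t = d / (norm a + norm b + 1)"
    have t: "t > 0" using d by (simp add: t_def add_nonneg_pos)
    have small: "dist (u + s *\<^sub>R a + r *\<^sub>R b) u < d" if "0 \<le> s" "s \<le> t" "0 \<le> r" "r \<le> t" for s r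
    proof -
      have "norm (s *\<^sub>R a + r *\<^sub>R b) \<le> s * norm a + r * norm b"
        using norm_triangle_ineq[of "s *\<^sub>R a" "r *\<^sub>R b"] that by simp
      also have "\<dots> \<le> t * norm a + t * norm b"
        using that by (intro add_mono mult_right_mono) auto
      also have "\<dots> < t * (norm a + norm b + 1)" using t by (simp add: algebra_simps)
      also have "\<dots> = d"
        using add_nonneg_pos[of "norm a + norm b" 1] by (simp add: t_def)
      finally show ?thesis by (simp add: dist_norm add.assoc)
    qed
    have small'': "u + s *\<^sub>R a + r *\<^sub>R b \<in> U" if "0 \<le> s" "s \<le> t" "0 \<le> r" "r \<le> t" for s r
      using d(2)[OF small] that by blast
    have small': "u + s *\<^sub>R b + r *\<^sub>R a \<in> U" if "0 \<le> s" "s \<le> t" "0 \<le> r" "r \<le> t" for s r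
      using small''[OF that(3,4,1,2)] by (simp add: add_ac)
    have sw: "u + s *\<^sub>R b + r *\<^sub>R a = u + r *\<^sub>R a + s *\<^sub>R b" for s r :: real by simp
    obtain s r where 1: "0 \<le> s" "s \<le> t" "0 \<le> r" "r \<le> t"
      "f (u + t *\<^sub>R a + t *\<^sub>R b) - f (u + t *\<^sub>R a) - f (u + t *\<^sub>R b) + f u = t^2 * f'' a (u + s *\<^sub>R a + r *\<^sub>R b) b"
      by (rule second_difference_mvt[of U f f' a "f'' a" t u b], erule f, erule f'',
          erule (3) small'', rule t, rule that)
    obtain s' r' where 2: "0 \<le> s'" "s' \<le> t" "0 \<le> r'" "r' \<le> t"
      "f (u + t *\<^sub>R b + t *\<^sub>R a) - f (u + t *\<^sub>R b) - f (u + t *\<^sub>R a) + f u = t^2 * f'' b (u + s' *\<^sub>R b + r' *\<^sub>R a) a"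
      by (rule second_difference_mvt[of U f f' b "f'' b" t u a], erule f, erule f'',
          erule (3) small', rule t, rule that)
    have "t^2 * f'' a (u + s *\<^sub>R a + r *\<^sub>R b) b = t^2 * f'' b (u + r' *\<^sub>R a + s' *\<^sub>R b) a"
      using 1(5) 2(5) unfolding sw[of t t] sw[of s' r'] by linarith
    then have "f'' a (u + s *\<^sub>R a + r *\<^sub>R b) b = f'' b (u + r' *\<^sub>R a + s' *\<^sub>R b) a"
      using t by simp
    then have "\<bar>f'' a (u + s *\<^sub>R a + r *\<^sub>R b) b - f'' a u b\<bar> < e / 2"
      "\<bar>f'' a (u + s *\<^sub>R a + r *\<^sub>R b) b - f'' b u a\<bar> < e / 2"
      using d(2)[OF small[OF 1(1-4)]] d(2)[OF small[OF 2(3,4,1,2)]] by simp_all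
    then show ?thesis
      unfolding abs_less_iff by linarith
  qed
  show ?thesis
    by (rule ccontr) (use near[of "\<bar>f'' a u b - f'' b u a\<bar>"] in simp)
qed

lemma smooth_on_second_derivative_commute:
  fixes f :: "'a::real_normed_vector \<Rightarrow> 'b::euclidean_space"
  assumes U: "open U" "u \<in> U" and f: "smooth_on U f"
  shows "frechet_derivative (\<lambda>v. frechet_derivative f (at v) a) (at u) b =
         frechet_derivative (\<lambda>v. frechet_derivative f (at v) b) (at u) a"
proof (rule euclidean_eqI)
  fix i :: 'b
  note [derivative_intros] = smooth_on_has_derivative[OF f]
    smooth_on_has_derivative[OF smooth_on_frechet_derivative[OF f]]
  show "frechet_derivative (\<lambda>v. frechet_derivative f (at v) a) (at u) b \<bullet> i =
         frechet_derivative (\<lambda>v. frechet_derivative f (at v) b) (at u) a \<bullet> i"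
    by (rule second_derivative_commute_real[OF U, where f = "\<lambda>v. f v \<bullet> i"
          and f' = "\<lambda>v c. frechet_derivative f (at v) c \<bullet> i"
          and f'' = "\<lambda>c v d. frechet_derivative (\<lambda>v. frechet_derivative f (at v) c) (at v) d \<bullet> i"])
      (auto intro!: derivative_eq_intros continuous_on_inner continuous_on_const
        smooth_on_imp_continuous_on[OF smooth_on_frechet_derivative[OF smooth_on_frechet_derivative[OF f]]])
qed

text \<open>Product rule with c merely continuous: the term that would involve a derivative of c
  carries the factor g u = 0. The error splits into c times the error of g, and c v - c u times the
  linear part.\<close>

lemma has_derivative_mult_vanishing:
  fixes g :: "'a::real_normed_vector \<Rightarrow> real"
  assumes g: "(g has_derivative g') (at u)" "g u = 0" and c: "isCont c u"
  shows "((\<lambda>v. c v * g v) has_derivative (\<lambda>a. c u * g' a)) (at u)"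
proof -
  obtain K where K: "K > 0" "\<And>x. norm (g' x) \<le> norm x * K"
    using bounded_linear.pos_bounded[OF has_derivative_bounded_linear[OF g(1)]] by blast
  define r where "r v = norm (g v - g u - g' (v - u)) / norm (v - u)" for v
  have r: "(r \<longlongrightarrow> 0) (at u)"
    using g(1) unfolding has_derivative_iff_norm r_def by simp
  have cu: "(c \<longlongrightarrow> c u) (at u)" using c by (simp add: isCont_def)
  have "((\<lambda>v. norm (c v * g v - c u * g u - c u * g' (v - u)) / norm (v - u)) \<longlongrightarrow> 0) (at u)"
  proof (rule Lim_null_comparison)
    show "((\<lambda>v. \<bar>c v\<bar> * r v + \<bar>c v - c u\<bar> * K) \<longlongrightarrow> 0) (at u)"
      by (rule tendsto_eq_intros r cu refl | simp)+
    show "\<forall>\<^sub>F v in at u. norm (norm (c v * g v - c u * g u - c u * g' (v - u)) / norm (v - u))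
        \<le> \<bar>c v\<bar> * r v + \<bar>c v - c u\<bar> * K"
    proof (rule eventually_at_filter[THEN iffD2], rule always_eventually, intro allI impI)
      fix v assume "v \<noteq> u"
      then have n: "norm (v - u) > 0" by simp
      have "c v * g v - c u * g u - c u * g' (v - u) =
          c v * (g v - g u - g' (v - u)) + (c v - c u) * g' (v - u)"
        using g(2) by (simp add: algebra_simps)
      then have "norm (c v * g v - c u * g u - c u * g' (v - u)) \<le>
          \<bar>c v\<bar> * norm (g v - g u - g' (v - u)) + \<bar>c v - c u\<bar> * norm (g' (v - u))"
        using norm_triangle_ineq[of "c v * (g v - g u - g' (v - u))" "(c v - c u) * g' (v - u)"]
        by (simp add: abs_mult)
      also have "\<dots> \<le> \<bar>c v\<bar> * norm (g v - g u - g' (v - u)) + \<bar>c v - c u\<bar> * (norm (v - u) * K)"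
        using K(2) by (intro add_left_mono mult_left_mono) auto
      also have "\<dots> = (\<bar>c v\<bar> * r v + \<bar>c v - c u\<bar> * K) * norm (v - u)"
        using n by (simp add: r_def field_simps)
      finally show "norm (norm (c v * g v - c u * g u - c u * g' (v - u)) / norm (v - u))
          \<le> \<bar>c v\<bar> * r v + \<bar>c v - c u\<bar> * K"
        using n by (simp add: pos_divide_le_eq)
    qed
  qed
  moreover have "bounded_linear (\<lambda>a. c u * g' a)"
    using has_derivative_bounded_linear[OF g(1)] bounded_linear_const_mult by blast
  ultimately show ?thesis
    unfolding has_derivative_iff_norm by simp
qed

lemma tendsto_det:
  fixes A :: "'a \<Rightarrow> real^'n^'n"
  assumes "\<And>i j. ((\<lambda>x. A x $ i $ j) \<longlongrightarrow> B $ i $ j) F"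
  shows "((\<lambda>x. det (A x)) \<longlongrightarrow> det B) F"
  unfolding det_def by (intro tendsto_sum tendsto_mult tendsto_const tendsto_prod assms)

text \<open>
  The coefficients of a tangent field \<open>z\<close> in the coordinate frame are continuous by Cramer's rule,
  and continuity suffices because the normal components of the frame vanish at \<open>u\<close>.
\<close>

lemma normal_part_of_derivative:
  fixes G' :: "real^'n \<Rightarrow> real^'n \<Rightarrow> 'b::euclidean_space" and \<nu> :: "'b \<Rightarrow> real"
  assumes G': "\<And>b. ((\<lambda>v. G' v b) has_derivative G'' b) (at u)"
    and lin: "\<And>v. v \<in> U \<Longrightarrow> linear (G' v)" and U: "open U" "u \<in> U"
    and inj: "inj (G' u)"
    and z: "(z has_derivative z') (at u)" "\<forall>\<^sub>F v in nhds u. z v \<in> range (G' v)" "z u = G' u b"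
    and \<nu>: "linear \<nu>" "\<And>a. \<nu> (G' u a) = 0"
  shows "\<nu> (z' a) = \<nu> (G'' b a)"
proof -
  obtain L where L: "linear (L :: 'b \<Rightarrow> real^'n)" "L \<circ> G' u = id"
    using linear_injective_left_inverse[OF lin[OF U(2)] inj] by blast
  have [simp]: "L (G' u x) = x" for x using L(2) by (simp add: fun_eq_iff)
  have bl: "bounded_linear L" "bounded_linear \<nu>"
    using L(1) \<nu>(1) by (auto intro: linear_conv_bounded_linear[THEN iffD1])
  \<comment> \<open>Composing with a left inverse L of G' u makes the frame a square matrix, the
    identity at u, hence invertible nearby; c is then Cramer's solution for the coefficients of
    z.\<close>
  define m where "m v = matrix (\<lambda>x. L (G' v x))" for v
  define c where "c v k = det (\<chi> i j. if j = k then L (z v) $ i else m v $ i $ j) / det (m v)" for v k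
  have m_lim: "((\<lambda>v. m v $ i $ j) \<longlongrightarrow> m u $ i $ j) (at u)" for i j
  proof -
    have "((\<lambda>v. L (G' v (axis j 1))) \<longlongrightarrow> L (G' u (axis j 1))) (at u)"
      using has_derivative_continuous[OF G'[of "axis j 1"]]
      by (intro bounded_linear.tendsto[OF bl(1)]) (simp only: isCont_def)
    from tendsto_vec_nth[OF this, of i] show ?thesis
      by (simp add: m_def matrix_def)
  qed
  have z_lim: "((\<lambda>v. L (z v) $ i) \<longlongrightarrow> L (z u) $ i) (at u)" for i
    using bounded_linear.tendsto[OF bl(1), of z, THEN tendsto_vec_nth]
      has_derivative_continuous[OF z(1)]
    by (simp add: isCont_def)
  have m_u: "m u = mat 1"
    by (simp add: m_def matrix_id_mat_1[unfolded id_def])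
  have det_lim: "((\<lambda>v. det (m v)) \<longlongrightarrow> det (m u)) (at u)"
    by (rule tendsto_det[OF m_lim])
  have cont: "isCont (\<lambda>v. c v k) u" for k
    unfolding c_def isCont_def
    by (intro tendsto_divide det_lim tendsto_det) (simp_all add: m_lim z_lim, simp add: m_u)
  have "\<forall>\<^sub>F v in at u. det (m v) \<noteq> 0"
    using det_lim by (rule tendsto_imp_eventually_ne) (simp add: m_u)
  then have det_ne: "\<forall>\<^sub>F v in nhds u. det (m v) \<noteq> 0"
    using m_u by (auto simp: eventually_at_filter elim: eventually_mono)
  have z_eq: "\<forall>\<^sub>F v in nhds u. z v = G' v (\<chi> k. c v k)"
    using det_ne z(2) eventually_nhds_in_open[OF U]
  proof eventually_elim
    case (elim v)
    then obtain x where x: "z v = G' v x" by blast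
    have "linear (\<lambda>x. L (G' v x))"
      using linear_compose[OF lin[OF elim(3)] L(1)] by (simp add: comp_def)
    then have "m v *v x = L (z v)"
      unfolding m_def x by (simp add: matrix_works)
    then have "x = (\<chi> k. c v k)"
      unfolding cramer[OF elim(1)] c_def by simp
    with x show ?case by simp
  qed
  have expand: "G' v x = (\<Sum>i\<in>UNIV. x $ i *\<^sub>R G' v (axis i 1))" if "v \<in> U" for v x
  proof -
    have "G' v x = G' v (\<Sum>i\<in>UNIV. x $ i *\<^sub>R axis i 1)"
      using basis_expansion[of x] by (simp add: scalar_mult_eq_scaleR)
    then show ?thesis
      by (simp add: linear_sum[OF lin[OF that]] linear_scale[OF lin[OF that]])
  qed
  have eq: "\<forall>\<^sub>F v in nhds u. \<nu> (z v) = (\<Sum>i\<in>UNIV. c v i * \<nu> (G' v (axis i 1)))"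
    using z_eq eventually_nhds_in_open[OF U]
    by eventually_elim (simp add: expand linear_sum[OF \<nu>(1)] linear_scale[OF \<nu>(1)])
  have cu: "(\<chi> k. c u k) = b"
  proof -
    have "m u *v b = L (z u)" by (simp add: m_u z(3))
    then show ?thesis
      using cramer[of "m u" b "L (z u)"] by (simp add: m_u c_def)
  qed
  have nG: "((\<lambda>v. \<nu> (G' v b)) has_derivative (\<lambda>a. \<nu> (G'' b a))) (at u)" for b
    using bounded_linear.has_derivative[OF bl(2) G'] .
  have "((\<lambda>v. \<Sum>i\<in>UNIV. c v i * \<nu> (G' v (axis i 1))) has_derivative
      (\<lambda>a. \<Sum>i\<in>UNIV. c u i * \<nu> (G'' (axis i 1) a))) (at u)"
    by (intro has_derivative_sum has_derivative_mult_vanishing nG cont) (simp add: \<nu>)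
  then have 1: "((\<lambda>v. \<nu> (z v)) has_derivative (\<lambda>a. \<Sum>i\<in>UNIV. c u i * \<nu> (G'' (axis i 1) a))) (at u)"
    by (rule has_derivative_transform_eventually)
      (use eq eventually_nhds_x_imp_x[OF eq] in \<open>auto simp: eventually_at_filter elim: eventually_mono\<close>)
  have 2: "((\<lambda>v. \<nu> (z v)) has_derivative (\<lambda>a. \<nu> (z' a))) (at u)"
    using bounded_linear.has_derivative[OF bl(2) z(1)] .
  \<comment> \<open>G'' is given separately for each b. Differentiating the basis expansion of G' v
    b and using uniqueness of derivatives recovers linearity in b of its normal part.\<close>
  have 3: "((\<lambda>v. \<nu> (G' v b)) has_derivative (\<lambda>a. \<Sum>i\<in>UNIV. b $ i * \<nu> (G'' (axis i 1) a))) (at u)"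
  proof -
    have "((\<lambda>v. \<Sum>i\<in>UNIV. b $ i * \<nu> (G' v (axis i 1))) has_derivative
      (\<lambda>a. \<Sum>i\<in>UNIV. b $ i * \<nu> (G'' (axis i 1) a))) (at u)"
      by (intro has_derivative_sum has_derivative_mult_right nG)
    then show ?thesis
      by (rule has_derivative_transform_within_open[OF _ U])
        (simp add: expand[of _ b] linear_sum[OF \<nu>(1)] linear_scale[OF \<nu>(1)])
  qed
  show ?thesis
    using has_derivative_unique[OF 1 2] has_derivative_unique[OF 3 nG] cu
    by (auto simp: fun_eq_iff)
qed

section \<open>Change of parametrization, tangent spaces and flat derivatives\<close>

lemma local_param_has_derivative:
  assumes "local_param M F U \<phi>" "u \<in> U"
  shows "((F \<circ> \<phi>) has_derivative frechet_derivative (F \<circ> \<phi>) (at u)) (at u)"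
    and "inj (frechet_derivative (F \<circ> \<phi>) (at u))"
    and "linear (frechet_derivative (F \<circ> \<phi>) (at u))"
proof -
  show 1: "((F \<circ> \<phi>) has_derivative frechet_derivative (F \<circ> \<phi>) (at u)) (at u)"
    using assms smooth_on_has_derivative unfolding local_param_def by blast
  show "inj (frechet_derivative (F \<circ> \<phi>) (at u))"
    using assms unfolding local_param_def by blast
  show "linear (frechet_derivative (F \<circ> \<phi>) (at u))"
    using 1 by (rule has_derivative_linear)
qed

text \<open>T is \<psi> followed by the inverse of \<phi>. The homeomorphisms give continuity only;
  \<open>has_derivative_implicit\<close> makes T differentiable at w, and the chain rule then
  factors the derivative of one immersion through the other.\<close>

lemma local_param_transition:
  fixes F :: "'p \<Rightarrow> 'n::finite affine_space"
  assumes \<phi>: "local_param M F U \<phi>" "u \<in> U" and \<psi>: "local_param M F W \<psi>" "w \<in> W"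
    and eq: "\<phi> u = \<psi> w"
  obtains T T' where "(T has_derivative T') (at w)" "T w = u"
    "\<forall>\<^sub>F v in nhds w. v \<in> W \<and> T v \<in> U \<and> \<phi> (T v) = \<psi> v"
    "frechet_derivative (F \<circ> \<psi>) (at w) = frechet_derivative (F \<circ> \<phi>) (at u) \<circ> T'"
proof -
  let ?G = "frechet_derivative (F \<circ> \<phi>) (at u)" and ?H = "frechet_derivative (F \<circ> \<psi>) (at w)"
  have oU: "open U" "openin M (\<phi> ` U)" and oW: "open W"
    using \<phi>(1) \<psi>(1) unfolding local_param_def by blast+
  obtain g where "homeomorphic_maps (top_of_set U) (subtopology M (\<phi> ` U)) \<phi> g"
    using \<phi>(1) unfolding local_param_def homeomorphic_map_maps by blast
  then have g: "continuous_map (subtopology M (\<phi> ` U)) (top_of_set U) g" "\<And>x. x \<in> U \<Longrightarrow> g (\<phi> x) = x"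
    unfolding homeomorphic_maps_def by auto
  have c\<psi>: "continuous_map (top_of_set W) M \<psi>"
    using \<psi>(1) unfolding local_param_def
    by (metis homeomorphic_imp_continuous_map continuous_map_in_subtopology)
  define Q where "Q = {v \<in> W. \<psi> v \<in> \<phi> ` U}"
  have "openin (top_of_set W) Q"
    using openin_continuous_map_preimage[OF c\<psi> oU(2)] by (simp add: Q_def)
  then have oO: "open Q" "w \<in> Q"
    using oW openin_open_trans \<psi>(2) \<phi>(2) eq by (auto simp: Q_def intro: rev_image_eqI)
  have "continuous_map (top_of_set Q) (subtopology M (\<phi> ` U)) \<psi>"
    unfolding continuous_map_in_subtopology
    using continuous_map_from_subtopology[OF c\<psi>, of Q]
    by (auto simp: Q_def subtopology_subtopology Int_absorb1 Collect_restrict)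
  then have "continuous_map (top_of_set Q) (top_of_set U) (g \<circ> \<psi>)"
    using g(1) by (rule continuous_map_compose)
  then have "continuous_on Q (g \<circ> \<psi>)" by simp
  then have cT: "isCont (g \<circ> \<psi>) w"
    using oO continuous_on_eq_continuous_at by blast
  have ev: "\<forall>\<^sub>F v in nhds w. v \<in> Q" using oO by (simp add: eventually_nhds_in_open)
  have Tw: "(g \<circ> \<psi>) w = u" using g(2)[OF \<phi>(2)] eq by simp
  obtain L where L: "linear L" "L \<circ> ?G = id"
    using linear_injective_left_inverse local_param_has_derivative[OF \<phi>] by blast
  have ev2: "\<forall>\<^sub>F v in nhds w. v \<in> W \<and> (g \<circ> \<psi>) v \<in> U \<and> \<phi> ((g \<circ> \<psi>) v) = \<psi> v"
    using ev by eventually_elim (use g(2) in \<open>auto simp: Q_def\<close>)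
  have T': "((g \<circ> \<psi>) has_derivative L \<circ> ?H) (at w)"
  proof (rule has_derivative_implicit[OF cT])
    show "((F \<circ> \<phi>) has_derivative ?G) (at ((g \<circ> \<psi>) w))"
      using local_param_has_derivative(1)[OF \<phi>] Tw by simp
    show "bounded_linear L" using L(1) by (simp add: linear_conv_bounded_linear)
    show "L (?G x) = x" for x using L(2) by (simp add: fun_eq_iff)
    show "((F \<circ> \<psi>) has_derivative ?H) (at w)" by (rule local_param_has_derivative(1)[OF \<psi>])
    show "\<forall>\<^sub>F v in nhds w. (F \<circ> \<phi>) ((g \<circ> \<psi>) v) = (F \<circ> \<psi>) v"
      using ev2 by eventually_elim simp
  qed
  have "((F \<circ> \<phi> \<circ> (g \<circ> \<psi>)) has_derivative ?G \<circ> (L \<circ> ?H)) (at w)"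
    using T' by (rule diff_chain_at) (use local_param_has_derivative(1)[OF \<phi>] Tw in simp)
  then have "((F \<circ> \<psi>) has_derivative ?G \<circ> (L \<circ> ?H)) (at w)"
    by (rule has_derivative_transform_eventually)
      (use ev2 eventually_nhds_x_imp_x[OF ev2] in \<open>auto simp: eventually_at_filter elim: eventually_mono\<close>)
  then have "?H = ?G \<circ> (L \<circ> ?H)"
    using has_derivative_unique local_param_has_derivative(1)[OF \<psi>] by blast
  then show ?thesis
    using that[OF T' Tw ev2] by blast
qed

lemma tangent_space_eq:
  fixes F :: "'p \<Rightarrow> 'n::finite affine_space"
  assumes "local_param M F U \<phi>" "u \<in> U"
  shows "tangent_space M F (\<phi> u) = range (frechet_derivative (F \<circ> \<phi>) (at u))"
proof
  show "range (frechet_derivative (F \<circ> \<phi>) (at u)) \<subseteq> tangent_space M F (\<phi> u)"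
    using assms local_param_has_derivative(1)[OF assms] unfolding tangent_space_def by blast
  show "tangent_space M F (\<phi> u) \<subseteq> range (frechet_derivative (F \<circ> \<phi>) (at u))"
  proof
    fix X assume "X \<in> tangent_space M F (\<phi> u)"
    then obtain W \<psi> w H' a where H: "local_param M F W \<psi>" "w \<in> W" "\<phi> u = \<psi> w"
      "((F \<circ> \<psi>) has_derivative H') (at w)" "X = H' a"
      unfolding tangent_space_def by auto
    obtain T' where "frechet_derivative (F \<circ> \<psi>) (at w) = frechet_derivative (F \<circ> \<phi>) (at u) \<circ> T'"
      using local_param_transition[OF assms H(1-3)] by metis
    then show "X \<in> range (frechet_derivative (F \<circ> \<phi>) (at u))"
      using H(5) frechet_derivative_at[OF H(4)] by simp
  qed
qed

text \<open>The value is independent of the parametrization: the vectors representing X correspond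
  under T' by injectivity, and the chain rule matches the derivatives of Z.\<close>

lemma flat_deriv_eq:
  fixes F :: "'p \<Rightarrow> 'n::finite affine_space"
  assumes \<phi>: "local_param M F U \<phi>" "u \<in> U" and Z: "((Z \<circ> \<phi>) has_derivative Z') (at u)"
  shows "flat_deriv M F (\<phi> u) (frechet_derivative (F \<circ> \<phi>) (at u) a) Z = Z' a"
  unfolding flat_deriv_def
proof (rule the_equality, goal_cases)
  case 1
  then show ?case
    using assms local_param_has_derivative(1)[OF \<phi>] by blast
next
  case (2 y)
  then obtain W \<psi> w H' Y' b where H: "local_param M F W \<psi>" "w \<in> W" "\<phi> u = \<psi> w"
      "((F \<circ> \<psi>) has_derivative H') (at w)" "((Z \<circ> \<psi>) has_derivative Y') (at w)"
      "H' b = frechet_derivative (F \<circ> \<phi>) (at u) a" "y = Y' b"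
    by metis
  obtain T T' where T: "(T has_derivative T') (at w)" "T w = u"
    "\<forall>\<^sub>F v in nhds w. v \<in> W \<and> T v \<in> U \<and> \<phi> (T v) = \<psi> v"
    "frechet_derivative (F \<circ> \<psi>) (at w) = frechet_derivative (F \<circ> \<phi>) (at u) \<circ> T'"
    using local_param_transition[OF \<phi> H(1-3)] by blast
  have "frechet_derivative (F \<circ> \<phi>) (at u) (T' b) = frechet_derivative (F \<circ> \<phi>) (at u) a"
    using T(4) H(6) frechet_derivative_at[OF H(4)] by (simp add: fun_eq_iff)
  then have a: "T' b = a"
    using local_param_has_derivative(2)[OF \<phi>] by (simp add: inj_eq)
  have "((Z \<circ> \<phi> \<circ> T) has_derivative Z' \<circ> T') (at w)"
    using T(1) by (rule diff_chain_at) (use Z T(2) in simp)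
  then have "((Z \<circ> \<psi>) has_derivative Z' \<circ> T') (at w)"
    by (rule has_derivative_transform_eventually)
      (use T(3) eventually_nhds_x_imp_x[OF T(3)] in \<open>auto simp: eventually_at_filter elim: eventually_mono\<close>)
  then have "Y' = Z' \<circ> T'"
    using has_derivative_unique H(5) by blast
  then show ?case using a H(7) by simp
qed

lemma local_param_inj_on: "local_param M F U \<phi> \<Longrightarrow> inj_on \<phi> U"
  unfolding local_param_def homeomorphic_map_def by simp

lemma subspace_tangent_space:
  fixes F :: "'p \<Rightarrow> 'n::finite affine_space"
  assumes "local_param M F U \<phi>" "u \<in> U"
  shows "subspace (tangent_space M F (\<phi> u))" "dim (tangent_space M F (\<phi> u)) = CARD('n)"
proof -
  note g = local_param_has_derivative[OF assms]
  show "subspace (tangent_space M F (\<phi> u))"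
    unfolding tangent_space_eq[OF assms] using linear_subspace_image[OF g(3) subspace_UNIV] .
  show "dim (tangent_space M F (\<phi> u)) = CARD('n)"
    unfolding tangent_space_eq[OF assms] using dim_image_eq[OF g(3), of UNIV] g(2) by simp
qed

text \<open>The Euclidean product serves only to represent a conormal y, with which normal
  components are read off as y \<bullet> x.\<close>

lemma tangent_space_hyperplane:
  fixes F :: "'p \<Rightarrow> 'n::finite affine_space"
  assumes "local_param M F U \<phi>" "u \<in> U"
  obtains y where "tangent_space M F (\<phi> u) = {x. y \<bullet> x = 0}"
proof -
  let ?V = "tangent_space M F (\<phi> u)"
  note V = subspace_tangent_space[OF assms]
  have D: "DIM('n affine_space) = CARD('n) + 1" by simp
  obtain y where y: "y \<noteq> 0" "span ?V \<subseteq> {x. y \<bullet> x = 0}"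
    using lowdim_subset_hyperplane[of ?V] V(2) D by auto
  have "?V = {x. y \<bullet> x = 0}"
  proof (rule subspace_dim_equal[OF V(1) subspace_hyperplane])
    show "?V \<subseteq> {x. y \<bullet> x = 0}" using y(2) span_superset by blast
    show "dim {x. y \<bullet> x = 0} \<le> dim ?V" using dim_hyperplane[OF y(1)] V(2) D by simp
  qed
  then show ?thesis by (rule that)
qed

text \<open>A tangent field comes with a parametrization of its own; its differentiability and
  tangency are carried over to the given \<phi>.\<close>

lemma tangent_field_near_has_derivative:
  fixes F :: "'p \<Rightarrow> 'n::finite affine_space"
  assumes \<phi>: "local_param M F U \<phi>" "u \<in> U" and Z: "tangent_field_near M F (\<phi> u) Z"
  obtains Z' where "((Z \<circ> \<phi>) has_derivative Z') (at u)"
    "\<forall>\<^sub>F v in nhds u. (Z \<circ> \<phi>) v \<in> range (frechet_derivative (F \<circ> \<phi>) (at v))"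
proof -
  obtain W \<psi> w where \<psi>: "local_param M F W \<psi>" "w \<in> W" "\<psi> w = \<phi> u" "smooth_on W (Z \<circ> \<psi>)"
    "\<And>q. q \<in> \<psi> ` W \<Longrightarrow> Z q \<in> tangent_space M F q"
    using Z unfolding tangent_field_near_def by (metis imageE)
  obtain T T' where T: "(T has_derivative T') (at u)" "T u = w"
    "\<forall>\<^sub>F v in nhds u. v \<in> U \<and> T v \<in> W \<and> \<psi> (T v) = \<phi> v"
    using local_param_transition[OF \<psi>(1,2) \<phi> \<psi>(3)] by blast
  have "((Z \<circ> \<psi> \<circ> T) has_derivative frechet_derivative (Z \<circ> \<psi>) (at w) \<circ> T') (at u)"
    using T(1) by (rule diff_chain_at) (use smooth_on_has_derivative[OF \<psi>(4,2)] T(2) in simp)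
  then have "((Z \<circ> \<phi>) has_derivative frechet_derivative (Z \<circ> \<psi>) (at w) \<circ> T') (at u)"
    by (rule has_derivative_transform_eventually)
      (use T(3) eventually_nhds_x_imp_x[OF T(3)] in \<open>auto simp: eventually_at_filter elim: eventually_mono\<close>)
  moreover have "\<forall>\<^sub>F v in nhds u. (Z \<circ> \<phi>) v \<in> range (frechet_derivative (F \<circ> \<phi>) (at v))"
    using T(3)
  proof eventually_elim
    case (elim v)
    then have "Z (\<psi> (T v)) \<in> tangent_space M F (\<psi> (T v))"
      using \<psi>(5) by blast
    then show ?case
      using elim tangent_space_eq[OF \<phi>(1), of v] by simp
  qed
  ultimately show ?thesis by (rule that)
qed

text \<open>Provides a tangent field with any prescribed tangent value at the point. Without one,
  every c would satisfy the condition describing \<open>affine_fundamental_form\<close>.\<close>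

lemma coordinate_field_tangent:
  fixes F :: "'p \<Rightarrow> 'n::finite affine_space"
  assumes \<phi>: "local_param M F U \<phi>" "u \<in> U"
  shows "tangent_field_near M F (\<phi> u) (\<lambda>q. frechet_derivative (F \<circ> \<phi>) (at (inv_into U \<phi> q)) b)"
proof -
  let ?Z = "\<lambda>q. frechet_derivative (F \<circ> \<phi>) (at (inv_into U \<phi> q)) b"
  have inv: "inv_into U \<phi> (\<phi> v) = v" if "v \<in> U" for v
    using inv_into_f_f[OF local_param_inj_on[OF \<phi>(1)] that] .
  have "smooth_on U (?Z \<circ> \<phi>) \<longleftrightarrow> smooth_on U (\<lambda>v. frechet_derivative (F \<circ> \<phi>) (at v) b)"
    using \<phi>(1) by (intro smooth_on_cong) (auto simp: inv local_param_def)
  then have "smooth_on U (?Z \<circ> \<phi>)"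
    using \<phi>(1) smooth_on_frechet_derivative unfolding local_param_def by blast
  moreover have "?Z q \<in> tangent_space M F q" if "q \<in> \<phi> ` U" for q
    using that tangent_space_eq[OF \<phi>(1)] by (auto simp: inv)
  ultimately show ?thesis
    unfolding tangent_field_near_def using \<phi> by blast
qed

text \<open>The Gauss formula paired with the conormal. All tangent fields with the given value have
  the same normal part, so c exists; the coordinate field makes it unique.\<close>

lemma affine_fundamental_form_eq:
  fixes F :: "'p \<Rightarrow> 'n::finite affine_space"
  assumes \<phi>: "local_param M F U \<phi>" "u \<in> U"
    and y: "tangent_space M F (\<phi> u) = {x. y \<bullet> x = 0}" and N: "N \<notin> tangent_space M F (\<phi> u)"
  shows "affine_fundamental_form M F (\<phi> u) N
      (frechet_derivative (F \<circ> \<phi>) (at u) a) (frechet_derivative (F \<circ> \<phi>) (at u) b) =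
    (y \<bullet> frechet_derivative (\<lambda>v. frechet_derivative (F \<circ> \<phi>) (at v) b) (at u) a) / (y \<bullet> N)"
    (is "_ = ?c")
proof -
  let ?G = "\<lambda>v. frechet_derivative (F \<circ> \<phi>) (at v)"
  have yN: "y \<bullet> N \<noteq> 0" using y N by simp
  have U: "open U" and sm: "smooth_on U (F \<circ> \<phi>)" using \<phi>(1) unfolding local_param_def by blast+
  have normal: "y \<bullet> flat_deriv M F (\<phi> u) (?G u a) Z = y \<bullet> frechet_derivative (\<lambda>v. ?G v b) (at u) a"
    if Z: "tangent_field_near M F (\<phi> u) Z" "Z (\<phi> u) = ?G u b" for Z
  proof -
    obtain Z' where Z': "((Z \<circ> \<phi>) has_derivative Z') (at u)"
      "\<forall>\<^sub>F v in nhds u. (Z \<circ> \<phi>) v \<in> range (?G v)"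
      using tangent_field_near_has_derivative[OF \<phi> Z(1)] by blast
    have "y \<bullet> Z' a = y \<bullet> frechet_derivative (\<lambda>v. ?G v b) (at u) a"
    proof (rule normal_part_of_derivative[of ?G "\<lambda>b. frechet_derivative (\<lambda>v. ?G v b) (at u)" u U "Z \<circ> \<phi>"])
      show "((\<lambda>v. ?G v b) has_derivative frechet_derivative (\<lambda>v. ?G v b) (at u)) (at u)" for b
        using smooth_on_has_derivative[OF smooth_on_frechet_derivative[OF sm] \<phi>(2)] .
      show "y \<bullet> ?G u a = 0" for a
        using y tangent_space_eq[OF \<phi>] by auto
      show "linear ((\<bullet>) y)"
        by (simp add: bounded_linear.linear bounded_linear_inner_right)
    qed (use \<phi> U Z Z' local_param_has_derivative[OF \<phi>(1)] in simp_all)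
    then show ?thesis
      using flat_deriv_eq[OF \<phi> Z'(1)] by simp
  qed
  show ?thesis
    unfolding affine_fundamental_form_def
  proof (rule the_equality)
    show "\<forall>Z. tangent_field_near M F (\<phi> u) Z \<and> Z (\<phi> u) = ?G u b \<longrightarrow>
        flat_deriv M F (\<phi> u) (?G u a) Z - ?c *\<^sub>R N \<in> tangent_space M F (\<phi> u)"
      using yN by (auto simp: y normal inner_diff_right)
    fix c
    let ?Z = "\<lambda>q. ?G (inv_into U \<phi> q) b"
    assume "\<forall>Z. tangent_field_near M F (\<phi> u) Z \<and> Z (\<phi> u) = ?G u b \<longrightarrow>
        flat_deriv M F (\<phi> u) (?G u a) Z - c *\<^sub>R N \<in> tangent_space M F (\<phi> u)"
    moreover have Z: "tangent_field_near M F (\<phi> u) ?Z" "?Z (\<phi> u) = ?G u b"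
      using coordinate_field_tangent[OF \<phi>] inv_into_f_f[OF local_param_inj_on[OF \<phi>(1)] \<phi>(2)] by auto
    ultimately have "flat_deriv M F (\<phi> u) (?G u a) ?Z - c *\<^sub>R N \<in> tangent_space M F (\<phi> u)"
      by blast
    then have "y \<bullet> flat_deriv M F (\<phi> u) (?G u a) ?Z - c * (y \<bullet> N) = 0"
      unfolding y by (simp add: inner_diff_right)
    then show "c = ?c"
      using normal[OF Z] yN by (simp add: eq_divide_eq)
  qed
qed

section \<open>Symmetry of the Blaschke metric and of the shape form\<close>

lemma sym_form_on_range:
  fixes g :: "'a::real_vector \<Rightarrow> 'v::real_vector"
  assumes g: "linear g" and A: "\<And>a b. A (g a) (g b) = f b a"
    and f: "\<And>a b. f a b = f b a" "\<And>b. linear (f b)"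
  shows "sym_form_on (range g) A"
proof -
  \<comment> \<open>Linearity is given in the last argument of f, the direction of differentiation
    in the applications; symmetry of f transfers it to the argument of A needed here.\<close>
  have "A (g c) (g a + g b) = A (g c) (g a) + A (g c) (g b)" for a b c
    using linear_add[OF f(2)] by (simp flip: linear_add[OF g] add: A f(1)[of _ c])
  moreover have "A (g b) (c *\<^sub>R g a) = c * A (g b) (g a)" for a b c
    using linear_scale[OF f(2)] by (simp flip: linear_scale[OF g] add: A f(1)[of _ b])
  ultimately show ?thesis
    unfolding sym_form_on_def linear_form_on_def using f(1) by (auto simp: A)
qed

text \<open>The parametrization is taken from the smoothness of \<xi> at p, so that the immersion
  and \<xi> are smooth on the same domain.\<close>

lemma hypersurface_local_param:
  assumes "nondegenerate_hypersurface M F" "affine_normal M F \<xi>" "p \<in> topspace M"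
  obtains U \<phi> u where "local_param M F U \<phi>" "u \<in> U" "p = \<phi> u" "smooth_on U (\<xi> \<circ> \<phi>)"
  using assms unfolding affine_normal_def smooth_near_def by (metis imageE)

lemma local_param_in_topspace: "local_param M F U \<phi> \<Longrightarrow> u \<in> U \<Longrightarrow> \<phi> u \<in> topspace M"
  unfolding local_param_def using openin_subset by blast

lemma linear_second_derivative:
  assumes "smooth_on U f" "u \<in> U"
  shows "linear (\<lambda>a. c * (y \<bullet> frechet_derivative (\<lambda>v. frechet_derivative f (at v) b) (at u) a))"
proof -
  have "linear (frechet_derivative (\<lambda>v. frechet_derivative f (at v) b) (at u))"
    using smooth_on_has_derivative[OF smooth_on_frechet_derivative[OF assms(1)] assms(2)]
    by (rule has_derivative_linear)
  then show ?thesis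
    by (simp add: linear_iff inner_add_right algebra_simps)
qed

lemma blaschke_metric_sym_form:
  fixes F :: "'p \<Rightarrow> 'n::finite affine_space"
  assumes M: "nondegenerate_hypersurface M F" "affine_normal M F \<xi>" "p \<in> topspace M"
  shows "sym_form_on (tangent_space M F p) (blaschke_metric M F \<xi> p)"
    and "sym_form_on (tangent_space M F p) (shape_form M F \<xi> p)"
proof -
  obtain U \<phi> u where \<phi>: "local_param M F U \<phi>" "u \<in> U" and p: "p = \<phi> u"
    and \<xi>: "smooth_on U (\<xi> \<circ> \<phi>)"
    using hypersurface_local_param[OF M] .
  let ?G = "\<lambda>v. frechet_derivative (F \<circ> \<phi>) (at v)" and ?x = "\<lambda>v. frechet_derivative (\<xi> \<circ> \<phi>) (at v)"
  obtain y where y: "tangent_space M F (\<phi> u) = {x. y \<bullet> x = 0}"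
    using tangent_space_hyperplane[OF \<phi>] .
  have U: "open U" and G: "smooth_on U (F \<circ> \<phi>)" using \<phi>(1) unfolding local_param_def by blast+
  have N: "\<xi> (\<phi> u) \<notin> tangent_space M F (\<phi> u)"
    using M p unfolding affine_normal_def by blast
  define k where "k = 1 / (y \<bullet> \<xi> (\<phi> u))"
  have h: "blaschke_metric M F \<xi> p (?G u a) (?G u b) =
      k * (y \<bullet> frechet_derivative (\<lambda>v. ?G v b) (at u) a)" for a b
    unfolding blaschke_metric_def p k_def using affine_fundamental_form_eq[OF \<phi> y N] by simp
  show "sym_form_on (tangent_space M F p) (blaschke_metric M F \<xi> p)"
    unfolding p tangent_space_eq[OF \<phi>] unfolding p[symmetric]
  proof (rule sym_form_on_range[OF local_param_has_derivative(3)[OF \<phi>],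
        where f = "\<lambda>b a. k * (y \<bullet> frechet_derivative (\<lambda>v. ?G v b) (at u) a)"])
    show "k * (y \<bullet> frechet_derivative (\<lambda>v. ?G v a) (at u) b) =
        k * (y \<bullet> frechet_derivative (\<lambda>v. ?G v b) (at u) a)" for a b
      by (simp only: smooth_on_second_derivative_commute[OF U \<phi>(2) G, of a b])
  qed (rule h linear_second_derivative[OF G \<phi>(2)])+
  have shape: "flat_deriv M F (\<phi> v) (?G v a) \<xi> = ?x v a" if "v \<in> U" for v a
    using flat_deriv_eq[OF \<phi>(1) that smooth_on_has_derivative[OF \<xi> that]] .
  have tangent: "?x v a \<in> range (?G v)" if "v \<in> U" for v a
  proof -
    have "\<forall>X\<in>tangent_space M F (\<phi> v). flat_deriv M F (\<phi> v) X \<xi> \<in> tangent_space M F (\<phi> v)"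
      using M(2) local_param_in_topspace[OF \<phi>(1) that] unfolding affine_normal_def by blast
    then show ?thesis
      unfolding tangent_space_eq[OF \<phi>(1) that] using shape[OF that] by auto
  qed
  \<comment> \<open>The derivatives of \<open>\<xi>\<close> are tangent fields, so their normal parts are second derivatives of \<open>\<xi>\<close>.\<close>
  have S: "shape_form M F \<xi> p (?G u a) (?G u b) =
      - k * (y \<bullet> frechet_derivative (\<lambda>v. ?x v b) (at u) a)" for a b
  proof -
    obtain b' where b': "?x u b = ?G u b'" using tangent[OF \<phi>(2)] by blast
    have "y \<bullet> frechet_derivative (\<lambda>v. ?x v b) (at u) a = y \<bullet> frechet_derivative (\<lambda>v. ?G v b') (at u) a"
    proof (rule normal_part_of_derivative[of ?G "\<lambda>b. frechet_derivative (\<lambda>v. ?G v b) (at u)" u U "\<lambda>v. ?x v b"])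
      show "((\<lambda>v. ?G v b) has_derivative frechet_derivative (\<lambda>v. ?G v b) (at u)) (at u)" for b
        using smooth_on_has_derivative[OF smooth_on_frechet_derivative[OF G] \<phi>(2)] .
      show "((\<lambda>v. ?x v b) has_derivative frechet_derivative (\<lambda>v. ?x v b) (at u)) (at u)"
        using smooth_on_has_derivative[OF smooth_on_frechet_derivative[OF \<xi>] \<phi>(2)] .
      show "y \<bullet> ?G u a = 0" for a
        using y tangent_space_eq[OF \<phi>] by auto
      show "linear ((\<bullet>) y)"
        by (simp add: bounded_linear.linear bounded_linear_inner_right)
      show "\<forall>\<^sub>F v in nhds u. ?x v b \<in> range (?G v)"
        using eventually_nhds_in_open[OF U \<phi>(2)] by eventually_elim (rule tangent)
    qed (use \<phi> U b' local_param_has_derivative[OF \<phi>(1)] in simp_all)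
    moreover have "shape_operator M F \<xi> p (?G u b) = ?G u (- b')"
      using shape[OF \<phi>(2)] b' linear_neg[OF local_param_has_derivative(3)[OF \<phi>]]
      by (simp add: shape_operator_def p)
    \<comment> \<open>Linearity in the slot of b' is obtained by exchanging the two derivatives,
      which turns this slot into the direction of differentiation.\<close>
    moreover have "frechet_derivative (\<lambda>v. ?G v (- b')) (at u) a = - frechet_derivative (\<lambda>v. ?G v b') (at u) a"
    proof -
      have "linear (frechet_derivative (\<lambda>v. ?G v a) (at u))"
        using smooth_on_has_derivative[OF smooth_on_frechet_derivative[OF G] \<phi>(2)]
        by (rule has_derivative_linear)
      then show ?thesis
        unfolding smooth_on_second_derivative_commute[OF U \<phi>(2) G, of _ a] by (rule linear_neg)
    qed
    ultimately show ?thesis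
      unfolding shape_form_def by (simp add: h)
  qed
  show "sym_form_on (tangent_space M F p) (shape_form M F \<xi> p)"
    unfolding p tangent_space_eq[OF \<phi>] unfolding p[symmetric]
  proof (rule sym_form_on_range[OF local_param_has_derivative(3)[OF \<phi>],
        where f = "\<lambda>b a. - k * (y \<bullet> frechet_derivative (\<lambda>v. ?x v b) (at u) a)"])
    show "- k * (y \<bullet> frechet_derivative (\<lambda>v. ?x v a) (at u) b) =
        - k * (y \<bullet> frechet_derivative (\<lambda>v. ?x v b) (at u) a)" for a b
      by (simp only: smooth_on_second_derivative_commute[OF U \<phi>(2) \<xi>, of a b])
  qed (rule S linear_second_derivative[OF \<xi> \<phi>(2)])+
qed

theorem theorem7p1:
  fixes M :: "'p topology"
    and F :: "'p \<Rightarrow> 'n::finite affine_space"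
    and \<xi> :: "'p \<Rightarrow> 'n affine_space"
    and U :: "'p set"
    and \<rho> \<alpha>\<^sub>2 \<tau> :: "'p \<Rightarrow> real"
    and n :: real
    and V :: "'p \<Rightarrow> 'n affine_space set"
    and h S A RicR D RicB :: "'p \<Rightarrow> 'n affine_space tensor2"
    and R B :: "'p \<Rightarrow> 'n affine_space tensor4"
  assumes "CARD('n) \<ge> 4"
    and "nondegenerate_hypersurface M F"
    and "affine_normal M F \<xi>"
    and "quasi_umbilical_hypersurface 2 M F \<xi>"
    and "openin M U" and "U \<noteq> {}" and "U \<subseteq> nonumbilic_set M F \<xi>"
    and n_def: "n = real CARD('n)"
    and V_def: "V = tangent_space M F"
    and h_def: "h = blaschke_metric M F \<xi>"
    and S_def: "S = shape_form M F \<xi>"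
    and A_def: "A = (\<lambda>x. sub_smult (S x) (\<rho> x) (h x))"
    and rank_A: "\<forall>x\<in>U. form_rank (V x) (A x) = 2"
    and alpha2_def: "\<alpha>\<^sub>2 = (\<lambda>x. \<rho> x * (tr2 (V x) (h x) (A x) + (n - 1) * \<rho> x))"
    and tau_def: "\<tau> = (\<lambda>x.
          1 / 2 * ((tr2 (V x) (h x) (A x))\<^sup>2 - tr2 (V x) (h x) (sq2 (V x) (h x) (A x)))
          + (n - 2) * \<rho> x * (tr2 (V x) (h x) (A x) + (n - 2) * \<rho> x))"
    and R_def: "R = opozda_verstraelen M F \<xi>"
    and RicR_def: "RicR = (\<lambda>x. Ric (V x) (h x) (R x))"
    and D_def: "D = (\<lambda>x. sub_smult (RicR x) (\<alpha>\<^sub>2 x) (h x))"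
    and B_def: "B = (\<lambda>x X1 X2 X3 X4.
          R x X1 X2 X3 X4 - \<alpha>\<^sub>2 x / (2 * (n - 1)) * KN (h x) (h x) X1 X2 X3 X4)"
    and RicB_def: "RicB = (\<lambda>x. Ric (V x) (h x) (B x))"
  shows
    "(\<forall>x\<in>U. \<tau> x = 0 \<longrightarrow> form_rank (V x) (D x) \<le> 1)
   \<and> (\<forall>x\<in>U. \<tau> x \<noteq> 0 \<longrightarrow>
        form_rank (V x) (D x) \<ge> 2
      \<and> (\<forall>X1\<in>V x. \<forall>X2\<in>V x. \<forall>X3\<in>V x. \<forall>X4\<in>V x.
           (n - 2) * \<tau> x * R x X1 X2 X3 X4 =
             (n - 2) / 2 * KN (D x) (D x) X1 X2 X3 X4
             + (n - 2) * \<tau> x * (\<rho> x)\<^sup>2 / 2 * KN (h x) (h x) X1 X2 X3 X4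
             + (\<tau> x - scal (V x) (h x) (R x) + n * \<alpha>\<^sub>2 x) * KN (h x) (D x) X1 X2 X3 X4
             + KN (h x) (sq2 (V x) (h x) (D x)) X1 X2 X3 X4)
      \<and> (let \<phi> = 1 / \<tau> x;
             \<kappa> = scal (V x) (h x) (B x);
             RicB2 = sq2 (V x) (h x) (RicB x);
             t2 = tr2 (V x) (h x) RicB2
         in \<forall>X1\<in>V x. \<forall>X2\<in>V x. \<forall>X3\<in>V x. \<forall>X4\<in>V x.
              B x X1 X2 X3 X4 =
                \<phi> / 2 * KN (RicB x) (RicB x) X1 X2 X3 X4
                + \<phi> / (n - 2) * KN (h x) RicB2 X1 X2 X3 X4
                + (1 - \<kappa> * \<phi>) / (n - 2) * KN (h x) (RicB x) X1 X2 X3 X4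
                + ((\<kappa>\<^sup>2 - t2) * \<phi> - \<kappa>) / (2 * (n - 2) * (n - 1)) * KN (h x) (h x) X1 X2 X3 X4
            \<and> Weyl (V x) (h x) (B x) X1 X2 X3 X4 =
                \<phi> * (1 / 2 * KN (RicB x) (RicB x) X1 X2 X3 X4
                     + 1 / (n - 2) * KN (h x) RicB2 X1 X2 X3 X4
                     - \<kappa> / (n - 2) * KN (h x) (RicB x) X1 X2 X3 X4
                     + (\<kappa>\<^sup>2 - t2) / (2 * (n - 2) * (n - 1)) * KN (h x) (h x) X1 X2 X3 X4)))
   \<and> ((\<forall>x\<in>U. \<tau> x \<noteq> 0) \<and>
      (\<forall>x\<in>U. \<exists>\<rho>\<^sub>1 \<rho>\<^sub>2. \<forall>X\<in>V x. \<forall>Y\<in>V x.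
         sq2 (V x) (h x) (RicR x) X Y = \<rho>\<^sub>1 * RicR x X Y + \<rho>\<^sub>2 * h x X Y)
      \<longrightarrow>
      (\<forall>x\<in>U. let W = Weyl (V x) (h x) (R x) in
         \<forall>X1\<in>V x. \<forall>X2\<in>V x. \<forall>X3\<in>V x. \<forall>X4\<in>V x. \<forall>X\<in>V x. \<forall>Y\<in>V x.
           curv_dot (V x) (h x) W (R x) X1 X2 X3 X4 X Y
           - curv_dot (V x) (h x) (R x) W X1 X2 X3 X4 X Y =
             Tachibana (RicR x) W X1 X2 X3 X4 X Y
             - scal (V x) (h x) (R x) / (n - 1) * Tachibana (h x) W X1 X2 X3 X4 X Y))"
proof -
  have form: "quasi_umbilical_form (V x) (h x) (S x) (A x) (D x) (R x) (B x) (\<rho> x) n (\<alpha>\<^sub>2 x) (\<tau> x)"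
    if x: "x \<in> U" for x
  proof -
    have p: "x \<in> topspace M" using x assms(7) unfolding nonumbilic_set_def by blast
    obtain W \<phi> w where \<phi>: "local_param M F W \<phi>" "w \<in> W" "x = \<phi> w"
      using hypersurface_local_param[OF assms(2,3) p] by metis
    have N: "\<xi> x \<notin> tangent_space M F x"
      using assms(3) p unfolding affine_normal_def by blast
    show ?thesis
    proof
      show "subspace (V x)" "dim (V x) = CARD('n)"
        unfolding V_def \<phi>(3) by (rule subspace_tangent_space[OF \<phi>(1,2)])+
      show "sym_form_on (V x) (h x)" "sym_form_on (V x) (S x)"
        unfolding V_def h_def S_def by (rule blaschke_metric_sym_form[OF assms(2,3) p])+
      \<comment> \<open>Nondegeneracy is assumed for every transversal vector; the instance for the
        Blaschke metric is the vector \<xi> x.\<close>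
      show "X = 0" if "X \<in> V x" "\<And>Y. Y \<in> V x \<Longrightarrow> h x X Y = 0" for X
        using assms(2) p N that unfolding nondegenerate_hypersurface_def V_def h_def blaschke_metric_def
        by blast
      show "R x = (\<lambda>X1 X2 X3 X4. 1 / 2 * KN (S x) (S x) X1 X2 X3 X4)"
        by (simp add: R_def S_def opozda_verstraelen_def fun_eq_iff)
      show "4 \<le> CARD('n)" by (rule assms(1))
      show "form_rank (V x) (A x) = 2" using rank_A x by blast
    qed (simp_all only: n_def A_def alpha2_def tau_def D_def RicR_def B_def)
  qed
  show ?thesis
  proof (intro conjI ballI impI, goal_cases)
    case (1 x)
    then show ?case using quasi_umbilical_form.rank_D_le_1[OF form] by blast
  next
    case (2 x)
    then show ?case using quasi_umbilical_form.rank_D_ge_2[OF form] by blast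
  next
    case (3 x X1 X2 X3 X4)
    then show ?case using quasi_umbilical_form.R_formula[OF form] by blast
  next
    case (4 x)
    then show ?case
      unfolding Let_def RicB_def
      using quasi_umbilical_form.B_formula[OF form] quasi_umbilical_form.Weyl_B_formula[OF form] by blast
  next
    case (5 x)
    then obtain \<rho>\<^sub>1 \<rho>\<^sub>2 where Ric2: "\<And>X Y. X \<in> V x \<Longrightarrow> Y \<in> V x \<Longrightarrow>
        sq2 (V x) (h x) (Ric (V x) (h x) (R x)) X Y = \<rho>\<^sub>1 * Ric (V x) (h x) (R x) X Y + \<rho>\<^sub>2 * h x X Y"
      unfolding RicR_def by blast
    show ?case
      unfolding Let_def RicR_def
      using quasi_umbilical_form.Weyl_R_commutator[OF form, of x \<rho>\<^sub>1 \<rho>\<^sub>2] 5 Ric2 by blast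
  qed
qed

end
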